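(* Let $\Sigma\in\mathbb{R}^{N_x\times N_x}$, $\Sigma\succ 0$, and let the disturbance trajectory $w$ have support $\mathcal{W}=\{z\in\mathbb{R}^{N_x}: z^\top\Sigma^{-1}z\le1\}$. Suppose $Q^w\in\mathcal{Q}_N$, $Q^\xi\in\mathcal{Q}_C$, $Y\in\mathcal{Y}(G_C)$, $\overline{u}\in\mathbb{R}^{N_u}$, $P^w,P^\xi\in\mathbb{R}^{N_x\times N_x}$, $\overline{v},\overline{x}\in\mathbb{R}^{N_x}$, $\lambda,\beta\in\mathbb{R}_+$ satisfy $\lambda\ge\max\{1,\beta\}$ and $$\overline{x}=\widetilde{B}\,\overline{u}+\widetilde{H}\,\Pi_{\mathcal{C}}\overline{v},\qquad P^w=\widetilde{B}Q^w+\widetilde{L},\qquad P^\xi=\widetilde{B}Q^\xi+\widetilde{H}\,\Pi_{\mathcal{C}}(\lambda I-Y),$$ $$\big\|\Sigma^{1/2}(F_xP^w+F_uQ^w+F_w)^\top e_i\big\|_2+\big\|\Sigma^{1/2}(F_xP^\xi+F_uQ^\xi)^\top e_i\big\|_2\le e_i^\top(g-F_x\overline{x}-F_u\overline{u}),\quad i=1,\dots,m,$$ $$\Pi_{\mathcal{C}}(\overline{x}-\overline{v})=0,$$ $$\begin{bmatrix}\Pi_{\mathcal{C}}\widetilde{\Sigma}\Pi_{\mathcal{C}}^\top & \Pi_{\mathcal{C}}P^w & \Pi_{\mathcal{C}}P^\xi\\ {P^w}^\top\Pi_{\mathcal{C}}^\top & \beta\Sigma^{-1} & 0\\ {P^\xi}^\top\Pi_{\mathcal{C}}^\top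 & 0 & (\lambda-\beta)\Sigma^{-1}\end{bmatrix}\succeq 0,\qquad \widetilde{\Sigma}:=\lambda\Sigma-Y\Sigma-\Sigma Y^\top,$$ where $e_i\in\mathbb{R}^m$ is the $i$th standard basis vector. Then the affine control policy $$u=\overline{u}+Q^ww+Q^v(x-\overline{v}),\qquad Q^v=Q^\xi(\lambda I-Y)^{-1},$$ is feasible for the decentralized control design problem (D) defined in the context.
   Context: System. There are $N$ subsystems indexed by $V=\{1,\dots,N\}$ and a finite horizon $T\ge 1$. Subsystem $i$ has state $x_i(t)\in\mathbb{R}^{n_x^i}$, input $u_i(t)\in\mathbb{R}^{n_u^i}$, disturbance $w_i(t)\in\mathbb{R}^{n_x^i}$, with $$x_i(t+1)=\sum_{j=1}^N\big(A_{ij}(t)x_j(t)+B_{ij}(t)u_j(t)\big)+w_i(t),\quad t=0,\dots,T-1.$$ Put $n_x=\sum_i n_x^i$, $n_u=\sum_i n_u^i$, $N_x=n_x(T+1)$, $N_u=n_uT$, $w(-1):=x(0)$, $x=(x(0),\dots,x(T))\in\mathbb{R}^{N_x}$, $u=(u(0),\dots,u(T-1))\in\mathbb{R}^{N_u}$, $w=(w(-1),w(0),\dots,w(T-1))\in\mathbb{R}^{N_x}$, where $x(t),u(t),w(t)$ stack the subsystem components. $B,L$ are the matrices for which the dynamics read $x=Bu+Lw$. The disturbance trajectory $w$ is a zero-mean random vector with support $\mathcal{W}$. Given data: $F_x\in\mathbb{R}^{m\times N_x}$, $F_u\in\mathbb{R}^{m\times N_u}$, $F_w\in\mathbb{R}^{m\times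 N_x}$, $g\in\mathbb{R}^m$, and symmetric positive semidefinite $R_x,R_u$. Vector inequalities are componentwise. For a sequence, $y^{s:t}=(y(s),\dots,y(t))$. Information structure. A directed graph $G_I=(V,E_I)$ is given; $(j,i)\in E_I$ means subsystem $i$ measures $x_j$. Let $V_I^-(i)=\{j:(j,i)\in E_I\}$, $V_A^-(i)=\{j:\exists t\in\{0,\dots,T-1\},\,A_{ij}(t)\ne0\}$, $V_B^-(i)=\{j:\exists t\in\{0,\dots,T-1\},\,B_{ij}(t)\neq0\}$. Define $$\mathcal{N}(i)=\Big\{j\in V_I^-(i): V_A^-(j)\subseteq V_I^-(i),\ \bigcup_{k\in V_B^-(j)}V_I^-(k)\subseteq V_I^-(i)\Big\},\qquad \mathcal{C}(i)=V_I^-(i)\setminus\mathcal{N}(i),\qquad \mathcal{C}=\bigcup_{i\in V}\mathcal{C}(i).$$ For a trajectory $x\in\mathbb{R}^{N_x}$, $x_{\mathcal{C}}=\Pi_{\mathcal{C}}x\in\mathbb{R}^{N_x^{\mathcal{C}}}$ denotes the subvector $(x_{\mathcal{C}}(0),\dots,x_{\mathcal{C}}(T))$, where $x_{\mathcal{C}}(t)$ stacks $x_j(t)$, $j\in\mathcal{C}$, in ascending order; $\Pi_{\mathcal{C}}$ is the corresponding coordinate-projection matrix. Policies and problem (D). $\Phi$ is the set of policies $\phi=(\phi_i(\cdot,t))_{i,t}$, with measurable $\phi_i(\cdot,t)$, mapping $(w,y)\in\mathbb{R}^{N_x}\times\mathbb{R}^{N_x^{\mathcal{C}}}$ to an input trajectory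 $\phi(w,y)$ whose $(i,t)$ component is a function $\phi_i(\cdot,t)$ of $\{y_j^{0:t}: j\in\mathcal{C}(i)\}$ and $\{w_j^{-1:t-1}: j\in\mathcal{N}(i)\}$ only. Problem (D): minimize $\mathbb{E}[x^\top R_xx+u^\top R_uu]$ over $\phi\in\Phi$ subject to: for all $w\in\mathcal{W}$, $u=\phi(w,x_{\mathcal{C}})$, $x=Bu+Lw$ and $F_xx+F_uu+F_ww\le g$. (By causality $x$ and $u$ are determined recursively by $w$.) Surrogate dynamics. Given $\widetilde{u}\in\mathbb{R}^{N_u}$, $w\in\mathbb{R}^{N_x}$, $v=(v(0),\dots,v(T))\in\mathbb{R}^{N_x}$, $v_{\mathcal{C}}=\Pi_{\mathcal{C}}v$, the surrogate state $\widetilde{x}$ satisfies $\widetilde{x}(0)=w(-1)$ and $$\widetilde{x}_i(t+1)=\sum_{j\in V\setminus\mathcal{C}(i)}A_{ij}(t)\widetilde{x}_j(t)+\sum_{j\in\mathcal{C}(i)}A_{ij}(t)v_j(t)+\sum_{j=1}^NB_{ij}(t)\widetilde{u}_j(t)+w_i(t).$$ The matrices $\widetilde{B},\widetilde{L},\widetilde{H}$ are those for which this reads $\widetilde{x}=\widetilde{B}\widetilde{u}+\widetilde{L}w+\widetilde{H}v_{\mathcal{C}}$. Matrix subspaces. $\mathcal{Q}_N$ (resp. $\mathcal{Q}_C$) is the set of matrices $Q\in\mathbb{R}^{N_u\times N_x}$, viewed as $T\times(T+1)$ block matrices with blocks $Q(t,s)\in\mathbb{R}^{n_u\times n_x}$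 ($0\le t\le T-1$, $0\le s\le T$), each subdivided into $N\times N$ blocks $[Q(t,s)]_{ij}\in\mathbb{R}^{n_u^i\times n_x^j}$, such that $[Q(t,s)]_{ij}=0$ unless $t\ge s$ and $j\in\mathcal{N}(i)$ (resp. unless $t\ge s$ and $j\in\mathcal{C}(i)$). The information coupling graph $G_C=(V,E_C)$ has $E_C=\{(j,i)\in E_I: j\in\mathcal{C}(i)\}$, with out-neighborhoods $V_C^+(j)=\{i:(j,i)\in E_C\}$. $\mathcal{Y}(G_C)$ is the subspace of $Y\in\mathbb{R}^{N_x\times N_x}$, viewed as $(T+1)\times(T+1)$ block matrices with blocks $Y(t,s)\in\mathbb{R}^{n_x\times n_x}$ subdivided into blocks $[Y(t,s)]_{ij}\in\mathbb{R}^{n_x^i\times n_x^j}$, that are strictly block lower triangular ($Y(t,s)=0$ for $t\le s$) and satisfy $[Y(t,s)]_{ij}=0$ whenever $V_C^+(i)\nsubseteq V_C^+(j)$. *)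

theory Defs
  imports "HOL-Probability.Probability" "Jordan_Normal_Form.Gauss_Jordan_Elimination"
begin

unbundle no vec_syntax
unbundle no inner_syntax

text \<open>Vectors and matrices are those of Jordan_Normal_Form. Subsystems are numbered
  \<open>0, \<dots>, N - 1\<close>.\<close>

section \<open>Linear algebra\<close>

definition psd_mat :: "nat \<Rightarrow> real mat \<Rightarrow> bool" where
  "psd_mat n M \<longleftrightarrow> M \<in> carrier_mat n n \<and> M\<^sup>T = M \<and> (\<forall>v\<in>carrier_vec n. 0 \<le> v \<bullet> (M *\<^sub>v v))"

definition pd_mat :: "nat \<Rightarrow> real mat \<Rightarrow> bool" where
  "pd_mat n M \<longleftrightarrow> M \<in> carrier_mat n n \<and> M\<^sup>T = M \<and>
     (\<forall>v\<in>carrier_vec n. v \<noteq> 0\<^sub>v n \<longrightarrow> 0 < v \<bullet> (M *\<^sub>v v))"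

definition mat_sqrt :: "real mat \<Rightarrow> real mat" where
  "mat_sqrt M = (THE R. psd_mat (dim_row M) R \<and> R * R = M)"

definition minv :: "real mat \<Rightarrow> real mat" where
  "minv M = the (mat_inverse M)"

definition eucl_norm :: "real vec \<Rightarrow> real" where
  "eucl_norm v = sqrt (v \<bullet> v)"

definition append_cols :: "real mat \<Rightarrow> real mat \<Rightarrow> real mat" where
  "append_cols M M' = four_block_mat M M' (0\<^sub>m 0 (dim_col M)) (0\<^sub>m 0 (dim_col M'))"

definition block33 ::
  "real mat \<Rightarrow> real mat \<Rightarrow> real mat \<Rightarrow> real mat \<Rightarrow> real mat \<Rightarrow> real mat \<Rightarrow>
   real mat \<Rightarrow> real mat \<Rightarrow> real mat \<Rightarrow> real mat" where
  "block33 M11 M12 M13 M21 M22 M23 M31 M32 M33 =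
     four_block_mat M11 (append_cols M12 M13) (M21 @\<^sub>r M31) (four_block_mat M22 M23 M32 M33)"

text \<open>The Borel sigma-algebra of \<open>\<real>\<^sup>n\<close>, carried over to \<^term>\<open>carrier_vec n\<close>.\<close>

definition vec_borel :: "nat \<Rightarrow> real vec measure" where
  "vec_borel n =
     vimage_algebra (carrier_vec n) (\<lambda>v. \<lambda>k\<in>{..<n}. v $ k) (Pi\<^sub>M {..<n} (\<lambda>_. borel))"

section \<open>Stacked trajectories\<close>

text \<open>For component dimensions \<open>d 0, \<dots>, d (N - 1)\<close>, a trajectory stacks its values at times
  \<open>0, 1, \<dots>\<close>, and each value stacks its \<open>N\<close> components; \<open>pos d N t i k\<close> is the position of the
  \<open>k\<close>-th entry of component \<open>i\<close> at time \<open>t\<close>.\<close>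

definition pos :: "(nat \<Rightarrow> nat) \<Rightarrow> nat \<Rightarrow> nat \<Rightarrow> nat \<Rightarrow> nat \<Rightarrow> nat" where
  "pos d N t i k = t * (\<Sum>j<N. d j) + (\<Sum>j<i. d j) + k"

definition vblock :: "(nat \<Rightarrow> nat) \<Rightarrow> nat \<Rightarrow> nat \<Rightarrow> nat \<Rightarrow> real vec \<Rightarrow> real vec" where
  "vblock d N t i v = vec (d i) (\<lambda>k. v $ pos d N t i k)"

definition mblock :: "(nat \<Rightarrow> nat) \<Rightarrow> (nat \<Rightarrow> nat) \<Rightarrow> nat \<Rightarrow> real mat \<Rightarrow>
    nat \<Rightarrow> nat \<Rightarrow> nat \<Rightarrow> nat \<Rightarrow> real mat" where
  "mblock d d' N M t s i j =
     mat (d i) (d' j) (\<lambda>(k, l). M $$ (pos d N t i k, pos d' N s j l))"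

section \<open>Systems and problem data\<close>

text \<open>\<open>amat S t i j\<close> and \<open>bmat S t i j\<close> are \<open>A\<^sub>i\<^sub>j(t)\<close> and \<open>B\<^sub>i\<^sub>j(t)\<close>.\<close>

record dsystem =
  nsub :: nat
  horizon :: nat
  xdim :: "nat \<Rightarrow> nat"
  udim :: "nat \<Rightarrow> nat"
  amat :: "nat \<Rightarrow> nat \<Rightarrow> nat \<Rightarrow> real mat"
  bmat :: "nat \<Rightarrow> nat \<Rightarrow> nat \<Rightarrow> real mat"
  info_edges :: "(nat \<times> nat) set"

record 'o dproblem = dsystem +
  ncon :: nat
  Fx :: "real mat"
  Fu :: "real mat"
  Fw :: "real mat"
  gbound :: "real vec"
  Rx :: "real mat"
  Ru :: "real mat"
  noise_space :: "'o measure"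
  noise :: "'o \<Rightarrow> real vec"

definition Nx :: "'a dsystem_scheme \<Rightarrow> nat" where
  "Nx S = (\<Sum>i<nsub S. xdim S i) * (horizon S + 1)"

definition Nu :: "'a dsystem_scheme \<Rightarrow> nat" where
  "Nu S = (\<Sum>i<nsub S. udim S i) * horizon S"

abbreviation xblock :: "'a dsystem_scheme \<Rightarrow> nat \<Rightarrow> nat \<Rightarrow> real vec \<Rightarrow> real vec" where
  "xblock S \<equiv> vblock (xdim S) (nsub S)"

abbreviation ublock :: "'a dsystem_scheme \<Rightarrow> nat \<Rightarrow> nat \<Rightarrow> real vec \<Rightarrow> real vec" where
  "ublock S \<equiv> vblock (udim S) (nsub S)"

definition valid_system :: "'a dsystem_scheme \<Rightarrow> bool" where
  "valid_system S \<longleftrightarrow>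
     1 \<le> horizon S \<and>
     (\<forall>t<horizon S. \<forall>i<nsub S. \<forall>j<nsub S.
        amat S t i j \<in> carrier_mat (xdim S i) (xdim S j) \<and>
        bmat S t i j \<in> carrier_mat (xdim S i) (udim S j)) \<and>
     info_edges S \<subseteq> {..<nsub S} \<times> {..<nsub S}"

definition valid_problem :: "'o dproblem \<Rightarrow> bool" where
  "valid_problem P \<longleftrightarrow>
     valid_system P \<and>
     Fx P \<in> carrier_mat (ncon P) (Nx P) \<and>
     Fu P \<in> carrier_mat (ncon P) (Nu P) \<and>
     Fw P \<in> carrier_mat (ncon P) (Nx P) \<and>
     gbound P \<in> carrier_vec (ncon P) \<and>
     psd_mat (Nx P) (Rx P) \<and>
     psd_mat (Nu P) (Ru P) \<and>
     prob_space (noise_space P) \<and>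
     noise P \<in> noise_space P \<rightarrow>\<^sub>M vec_borel (Nx P) \<and>
     (\<forall>k<Nx P. integrable (noise_space P) (\<lambda>\<omega>. noise P \<omega> $ k) \<and>
        (\<integral>\<omega>. noise P \<omega> $ k \<partial>noise_space P) = 0)"

definition noise_support :: "'o dproblem \<Rightarrow> real vec set" where
  "noise_support P = {z \<in> carrier_vec (Nx P). \<forall>\<epsilon>>0.
     0 < measure (noise_space P) {\<omega> \<in> space (noise_space P). eucl_norm (noise P \<omega> - z) < \<epsilon>}}"

text \<open>A disturbance trajectory is \<open>w = (w(-1), w(0), \<dots>, w(T - 1))\<close>, so \<open>w(t)\<close> is its block
  number \<open>t + 1\<close>.\<close>

definition dynamics :: "'a dsystem_scheme \<Rightarrow> real vec \<Rightarrow> real vec \<Rightarrow> real vec \<Rightarrow> bool" where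
  "dynamics S x u w \<longleftrightarrow>
     (\<forall>i<nsub S. xblock S 0 i x = xblock S 0 i w) \<and>
     (\<forall>t<horizon S. \<forall>i<nsub S. \<forall>k<xdim S i.
        xblock S (t + 1) i x $ k =
          (\<Sum>j<nsub S. (amat S t i j *\<^sub>v xblock S t j x) $ k + (bmat S t i j *\<^sub>v ublock S t j u) $ k)
          + xblock S (t + 1) i w $ k)"

section \<open>Information structure\<close>

definition VI_in :: "'a dsystem_scheme \<Rightarrow> nat \<Rightarrow> nat set" where
  "VI_in S i = {j. (j, i) \<in> info_edges S}"

definition VA_in :: "'a dsystem_scheme \<Rightarrow> nat \<Rightarrow> nat set" where
  "VA_in S i = {j. j < nsub S \<and> (\<exists>t<horizon S. amat S t i j \<noteq> 0\<^sub>m (xdim S i) (xdim S j))}"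

definition VB_in :: "'a dsystem_scheme \<Rightarrow> nat \<Rightarrow> nat set" where
  "VB_in S i = {j. j < nsub S \<and> (\<exists>t<horizon S. bmat S t i j \<noteq> 0\<^sub>m (xdim S i) (udim S j))}"

definition Nset :: "'a dsystem_scheme \<Rightarrow> nat \<Rightarrow> nat set" where
  "Nset S i = {j \<in> VI_in S i. VA_in S j \<subseteq> VI_in S i \<and> (\<Union>k\<in>VB_in S j. VI_in S k) \<subseteq> VI_in S i}"

definition Cset :: "'a dsystem_scheme \<Rightarrow> nat \<Rightarrow> nat set" where
  "Cset S i = VI_in S i - Nset S i"

definition Call :: "'a dsystem_scheme \<Rightarrow> nat set" where
  "Call S = (\<Union>i<nsub S. Cset S i)"

definition coupling_edges :: "'a dsystem_scheme \<Rightarrow> (nat \<times> nat) set" where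
  "coupling_edges S = {(j, i) \<in> info_edges S. j \<in> Cset S i}"

definition VC_out :: "'a dsystem_scheme \<Rightarrow> nat \<Rightarrow> nat set" where
  "VC_out S j = {i. (j, i) \<in> coupling_edges S}"

text \<open>The trajectory \<open>x\<^sub>C\<close> is stacked like a state trajectory in which the components outside
  \<open>C\<close> have dimension 0.\<close>

definition xCdim :: "'a dsystem_scheme \<Rightarrow> nat \<Rightarrow> nat" where
  "xCdim S j = (if j \<in> Call S then xdim S j else 0)"

definition NxC :: "'a dsystem_scheme \<Rightarrow> nat" where
  "NxC S = (\<Sum>j<nsub S. xCdim S j) * (horizon S + 1)"

abbreviation xCblock :: "'a dsystem_scheme \<Rightarrow> nat \<Rightarrow> nat \<Rightarrow> real vec \<Rightarrow> real vec" where
  "xCblock S \<equiv> vblock (xCdim S) (nsub S)"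

definition projC :: "'a dsystem_scheme \<Rightarrow> real mat" where
  "projC S = mat (NxC S) (Nx S) (\<lambda>(r, c).
     if \<exists>t\<le>horizon S. \<exists>j\<in>Call S. \<exists>k<xdim S j.
          r = pos (xCdim S) (nsub S) t j k \<and> c = pos (xdim S) (nsub S) t j k
     then 1 else 0)"

section \<open>Policies and the decentralized control design problem\<close>

text \<open>A policy maps \<open>(w, y)\<close> to an input trajectory. The data available to subsystem \<open>i\<close> at time
  \<open>t\<close> are \<open>w\<^sub>j(-1), \<dots>, w\<^sub>j(t - 1)\<close> (the blocks \<open>0, \<dots>, t\<close> of \<open>w\<close>) for \<open>j\<close> in \<open>N(i)\<close>, and
  \<open>y\<^sub>j(0), \<dots>, y\<^sub>j(t)\<close> for \<open>j\<close> in \<open>C(i)\<close>.\<close>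

definition w_index :: "'a dsystem_scheme \<Rightarrow> nat \<Rightarrow> nat \<Rightarrow> (nat \<times> nat \<times> nat) set" where
  "w_index S i t = {(s, j, k). s \<le> t \<and> j \<in> Nset S i \<and> k < xdim S j}"

definition y_index :: "'a dsystem_scheme \<Rightarrow> nat \<Rightarrow> nat \<Rightarrow> (nat \<times> nat \<times> nat) set" where
  "y_index S i t = {(s, j, k). s \<le> t \<and> j \<in> Cset S i \<and> k < xdim S j}"

definition w_data :: "'a dsystem_scheme \<Rightarrow> nat \<Rightarrow> nat \<Rightarrow> real vec \<Rightarrow> nat \<times> nat \<times> nat \<Rightarrow> real" where
  "w_data S i t w = (\<lambda>(s, j, k)\<in>w_index S i t. xblock S s j w $ k)"

definition y_data :: "'a dsystem_scheme \<Rightarrow> nat \<Rightarrow> nat \<Rightarrow> real vec \<Rightarrow> nat \<times> nat \<times> nat \<Rightarrow> real" where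
  "y_data S i t y = (\<lambda>(s, j, k)\<in>y_index S i t. xCblock S s j y $ k)"

definition policies :: "'a dsystem_scheme \<Rightarrow> (real vec \<Rightarrow> real vec \<Rightarrow> real vec) set" where
  "policies S = {\<phi>.
     (\<forall>w\<in>carrier_vec (Nx S). \<forall>y\<in>carrier_vec (NxC S). \<phi> w y \<in> carrier_vec (Nu S)) \<and>
     (\<forall>i<nsub S. \<forall>t<horizon S.
        \<exists>\<psi> \<in> Pi\<^sub>M (y_index S i t) (\<lambda>_. borel) \<Otimes>\<^sub>M Pi\<^sub>M (w_index S i t) (\<lambda>_. borel)
              \<rightarrow>\<^sub>M vec_borel (udim S i).
          \<forall>w\<in>carrier_vec (Nx S). \<forall>y\<in>carrier_vec (NxC S).
            ublock S t i (\<phi> w y) = \<psi> (y_data S i t y, w_data S i t w))}"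

definition closed_loop :: "'a dsystem_scheme \<Rightarrow> (real vec \<Rightarrow> real vec \<Rightarrow> real vec) \<Rightarrow>
    real vec \<Rightarrow> real vec \<Rightarrow> real vec \<Rightarrow> bool" where
  "closed_loop S \<phi> w x u \<longleftrightarrow>
     x \<in> carrier_vec (Nx S) \<and> u \<in> carrier_vec (Nu S) \<and>
     u = \<phi> w (projC S *\<^sub>v x) \<and> dynamics S x u w"

definition constraints :: "'o dproblem \<Rightarrow> real vec \<Rightarrow> real vec \<Rightarrow> real vec \<Rightarrow> bool" where
  "constraints P x u w \<longleftrightarrow> Fx P *\<^sub>v x + Fu P *\<^sub>v u + Fw P *\<^sub>v w \<le> gbound P"

definition feasible_D :: "'o dproblem \<Rightarrow> (real vec \<Rightarrow> real vec \<Rightarrow> real vec) \<Rightarrow> bool" where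
  "feasible_D P \<phi> \<longleftrightarrow>
     \<phi> \<in> policies P \<and>
     (\<forall>w\<in>noise_support P.
        (\<exists>!(x, u). closed_loop P \<phi> w x u) \<and>
        (\<forall>x u. closed_loop P \<phi> w x u \<longrightarrow> constraints P x u w))"

definition cost_D :: "'o dproblem \<Rightarrow> (real vec \<Rightarrow> real vec \<Rightarrow> real vec) \<Rightarrow> real" where
  "cost_D P \<phi> = (\<integral>\<omega>. (let (x, u) = (THE (x, u). closed_loop P \<phi> (noise P \<omega>) x u)
     in x \<bullet> (Rx P *\<^sub>v x) + u \<bullet> (Ru P *\<^sub>v u)) \<partial>noise_space P)"

section \<open>Surrogate dynamics and matrix subspaces\<close>

definition surrogate_dynamics ::
  "'a dsystem_scheme \<Rightarrow> real vec \<Rightarrow> real vec \<Rightarrow> real vec \<Rightarrow> real vec \<Rightarrow> bool" where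
  "surrogate_dynamics S x u w v \<longleftrightarrow>
     (\<forall>i<nsub S. xblock S 0 i x = xblock S 0 i w) \<and>
     (\<forall>t<horizon S. \<forall>i<nsub S. \<forall>k<xdim S i.
        xblock S (t + 1) i x $ k =
          (\<Sum>j\<in>{..<nsub S} - Cset S i. (amat S t i j *\<^sub>v xblock S t j x) $ k)
          + (\<Sum>j\<in>Cset S i. (amat S t i j *\<^sub>v xblock S t j v) $ k)
          + (\<Sum>j<nsub S. (bmat S t i j *\<^sub>v ublock S t j u) $ k)
          + xblock S (t + 1) i w $ k)"

definition surrogate_matrices ::
  "'a dsystem_scheme \<Rightarrow> real mat \<Rightarrow> real mat \<Rightarrow> real mat \<Rightarrow> bool" where
  "surrogate_matrices S Bt Lt Ht \<longleftrightarrow>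
     Bt \<in> carrier_mat (Nx S) (Nu S) \<and>
     Lt \<in> carrier_mat (Nx S) (Nx S) \<and>
     Ht \<in> carrier_mat (Nx S) (NxC S) \<and>
     (\<forall>x\<in>carrier_vec (Nx S). \<forall>u\<in>carrier_vec (Nu S). \<forall>w\<in>carrier_vec (Nx S). \<forall>v\<in>carrier_vec (Nx S).
        surrogate_dynamics S x u w v \<longleftrightarrow>
        x = Bt *\<^sub>v u + Lt *\<^sub>v w + Ht *\<^sub>v (projC S *\<^sub>v v))"

definition QN :: "'a dsystem_scheme \<Rightarrow> real mat set" where
  "QN S = {Q \<in> carrier_mat (Nu S) (Nx S).
     \<forall>t<horizon S. \<forall>s\<le>horizon S. \<forall>i<nsub S. \<forall>j<nsub S. \<not> (s \<le> t \<and> j \<in> Nset S i) \<longrightarrow>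
       mblock (udim S) (xdim S) (nsub S) Q t s i j = 0\<^sub>m (udim S i) (xdim S j)}"

definition QC :: "'a dsystem_scheme \<Rightarrow> real mat set" where
  "QC S = {Q \<in> carrier_mat (Nu S) (Nx S).
     \<forall>t<horizon S. \<forall>s\<le>horizon S. \<forall>i<nsub S. \<forall>j<nsub S. \<not> (s \<le> t \<and> j \<in> Cset S i) \<longrightarrow>
       mblock (udim S) (xdim S) (nsub S) Q t s i j = 0\<^sub>m (udim S i) (xdim S j)}"

definition Ysub :: "'a dsystem_scheme \<Rightarrow> real mat set" where
  "Ysub S = {Y \<in> carrier_mat (Nx S) (Nx S).
     \<forall>t\<le>horizon S. \<forall>s\<le>horizon S. \<forall>i<nsub S. \<forall>j<nsub S.
       (t \<le> s \<or> \<not> VC_out S i \<subseteq> VC_out S j) \<longrightarrow>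
       mblock (xdim S) (xdim S) (nsub S) Y t s i j = 0\<^sub>m (xdim S i) (xdim S j)}"

end

theory Submission
  imports Defs "Jordan_Normal_Form.Char_Poly"
begin

text \<open>
  Write \<open>\<Pi>\<close> for \<^term>\<open>projC\<close> and \<open>M = \<lambda> I - Y\<close>. When the exogenous signal \<open>v\<close> of the surrogate
  dynamics is the state itself, the surrogate recursion is the true one, so closed loop trajectories
  are the solutions of \<open>x = B u + L w + H \<Pi> x\<close> with the surrogate matrices \<open>B, L, H\<close>
  (\<open>dynamics_iff_matrices\<close>). The gain \<open>Q\<^sup>v = Q\<^sup>\<xi> M\<^sup>-\<^sup>1\<close> inherits the sparsity of \<open>Q\<^sup>\<xi>\<close>
  (\<open>sparse_gain_resolvent\<close>), hence the policy respects the information structure, and being causal it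
  determines a unique closed loop trajectory (\<open>closed_loop_equation\<close>).

  Suppose \<open>\<Pi> x = \<Pi> (v\<^sub>0 + M \<xi>)\<close>, where \<open>v\<^sub>0, x\<^sub>0, u\<^sub>0\<close> are the nominal signals. Both \<open>Q\<^sup>v\<close> and
  \<open>H \<Pi>\<close> see only the components in \<open>C\<close>, so \<open>Q\<^sup>v (x - v\<^sub>0) = Q\<^sup>\<xi> \<xi>\<close> and the closed loop becomes
  \<open>x = x\<^sub>0 + P\<^sup>w w + P\<^sup>\<xi> \<xi>\<close>, \<open>u = u\<^sub>0 + Q\<^sup>w w + Q\<^sup>\<xi> \<xi>\<close> (\<open>surrogate_response\<close>). The norm inequalities
  are exactly what makes the constraints hold for all \<open>w\<close> and \<open>\<xi>\<close> in the ellipsoid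
  (\<open>ellipsoid_row_bound\<close>). It remains to represent the closed loop by a \<open>\<xi>\<close> in the ellipsoid.

  The equation \<open>\<Pi> M \<xi> = \<Pi> (x - v\<^sub>0)\<close> leaves \<open>\<xi>\<close> free outside \<open>C\<close>; take the solution of least
  \<open>\<Sigma>\<^sup>-\<^sup>1\<close>-norm, \<open>\<xi> = \<Sigma> (\<Pi> M)\<^sup>T y\<close> (\<open>minimal_norm_preimage\<close>). Its squared norm is
  \<open>q = y \<bullet> \<Pi> (P\<^sup>w w + P\<^sup>\<xi> \<xi>)\<close>. Since \<open>\<lambda> (\<lambda> \<Sigma> - Y \<Sigma> - \<Sigma> Y\<^sup>T) \<le> M \<Sigma> M\<^sup>T\<close>, evaluating the block matrix
  inequality at \<open>(- \<lambda> y, w, \<xi>)\<close> gives \<open>0 \<le> \<beta> (w \<bullet> \<Sigma>\<^sup>-\<^sup>1 w - q)\<close>, so \<open>q \<le> 1\<close> if \<open>\<beta> > 0\<close>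
  (\<open>LMI_imp_norm_le\<close>). If \<open>\<beta> = 0\<close>, the inequality forces \<open>\<Pi> P\<^sup>w = 0\<close> (\<open>LMI_imp_zero\<close>), and then \<open>\<xi> = 0\<close>
  represents the closed loop. Well-posedness provides \<open>x\<close> before \<open>\<xi>\<close>, so \<open>\<xi>\<close> is read
  off from \<open>x\<close> instead of being sought as a fixed point.
\<close>

section \<open>Quadratic forms\<close>

lemma minv_inverse:
  assumes A: "A \<in> carrier_mat n n"
    and inj: "\<And>v. v \<in> carrier_vec n \<Longrightarrow> A *\<^sub>v v = 0\<^sub>v n \<Longrightarrow> v = 0\<^sub>v n"
  shows "minv A \<in> carrier_mat n n" "A * minv A = 1\<^sub>m n" "minv A * A = 1\<^sub>m n"
proof -
  have "det A \<noteq> 0" using det_0_iff_vec_prod_zero_field[OF A] inj by blast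
  then have "A \<in> Units (ring_mat TYPE(real) n n)" by (rule det_non_zero_imp_unit[OF A])
  then obtain B where "mat_inverse A = Some B" using mat_inverse(1)[OF A] by fastforce
  with mat_inverse(2)[OF A this]
  show "minv A \<in> carrier_mat n n" "A * minv A = 1\<^sub>m n" "minv A * A = 1\<^sub>m n"
    by (auto simp: minv_def)
qed

lemma scalar_prod_self_nonneg: "0 \<le> (v :: real vec) \<bullet> v"
  by (auto simp: scalar_prod_def intro: sum_nonneg)

lemma scalar_prod_self_eq_0:
  assumes "v \<in> carrier_vec n" "(v :: real vec) \<bullet> v = 0"
  shows "v = 0\<^sub>v n"
proof
  have "(\<Sum>i\<in>{0..<n}. v $ i * v $ i) = 0" using assms by (simp add: scalar_prod_def)
  then have "\<forall>i\<in>{0..<n}. v $ i * v $ i = 0"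
    by (subst (asm) sum_nonneg_eq_0_iff) auto
  then show "v $ i = 0\<^sub>v n $ i" if "i < dim_vec (0\<^sub>v n)" for i using that by simp
qed (use assms in auto)

lemma scalar_prod_symmetric_mat:
  assumes "M \<in> carrier_mat n n" "M\<^sup>T = M" "v \<in> carrier_vec n" "w \<in> carrier_vec n"
  shows "v \<bullet> (M *\<^sub>v w) = w \<bullet> ((M :: real mat) *\<^sub>v v)"
  using transpose_vec_mult_scalar[OF assms(1,4,3)] assms
  by (metis comm_scalar_prod mult_mat_vec_carrier)

lemma quadratic_form_add_smult:
  assumes M: "M \<in> carrier_mat n n" "M\<^sup>T = M" and v: "v \<in> carrier_vec n" and w: "w \<in> carrier_vec n"
  shows "(v + s \<cdot>\<^sub>v w) \<bullet> (M *\<^sub>v (v + s \<cdot>\<^sub>v w))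
    = v \<bullet> (M *\<^sub>v v) + 2 * s * (v \<bullet> (M *\<^sub>v w)) + s\<^sup>2 * (w \<bullet> ((M :: real mat) *\<^sub>v w))"
proof -
  have [simp]: "M *\<^sub>v v \<in> carrier_vec n" "M *\<^sub>v w \<in> carrier_vec n" "s \<cdot>\<^sub>v w \<in> carrier_vec n"
    using M v w by auto
  have "(v + s \<cdot>\<^sub>v w) \<bullet> (M *\<^sub>v (v + s \<cdot>\<^sub>v w))
      = (v + s \<cdot>\<^sub>v w) \<bullet> (M *\<^sub>v v + s \<cdot>\<^sub>v (M *\<^sub>v w))"
    using v w by (simp add: mult_add_distrib_mat_vec[OF M(1)] mult_mat_vec[OF M(1)])
  also have "\<dots> = v \<bullet> (M *\<^sub>v v) + s * (v \<bullet> (M *\<^sub>v w)) + (s * (w \<bullet> (M *\<^sub>v v)) + s * (s * (w \<bullet> (M *\<^sub>v w))))"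
    using v w by (simp add: add_scalar_prod_distrib[of _ n] scalar_prod_add_distrib[of _ n])
  finally show ?thesis
    using scalar_prod_symmetric_mat[OF M v w] by (simp add: power2_eq_square algebra_simps)
qed

text \<open>The quadratic polynomial \<open>s \<mapsto> (v + s w) \<bullet> M (v + s w)\<close> is nonnegative, hence has
  nonpositive discriminant; when \<open>w \<bullet> M w = 0\<close> it is affine and must be constant.\<close>

lemma psd_mat_Cauchy_Schwarz:
  assumes "psd_mat n M" and v: "v \<in> carrier_vec n" and w: "w \<in> carrier_vec n"
  shows "(v \<bullet> (M *\<^sub>v w))\<^sup>2 \<le> (v \<bullet> (M *\<^sub>v v)) * (w \<bullet> (M *\<^sub>v w))"
proof -
  define a b c where "a = w \<bullet> (M *\<^sub>v w)" and "b = v \<bullet> (M *\<^sub>v w)" and "c = v \<bullet> (M *\<^sub>v v)"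
  have M: "M \<in> carrier_mat n n" "M\<^sup>T = M" using assms by (auto simp: psd_mat_def)
  have ac: "0 \<le> a" "0 \<le> c" using assms by (auto simp: psd_mat_def a_def c_def)
  have q: "0 \<le> c + 2 * s * b + s\<^sup>2 * a" for s
  proof -
    have "v + s \<cdot>\<^sub>v w \<in> carrier_vec n" using v w by auto
    then have "0 \<le> (v + s \<cdot>\<^sub>v w) \<bullet> (M *\<^sub>v (v + s \<cdot>\<^sub>v w))"
      using assms(1) unfolding psd_mat_def by blast
    then show ?thesis by (simp add: quadratic_form_add_smult[OF M v w] a_def b_def c_def)
  qed
  show ?thesis
  proof (cases "a = 0")
    case True
    have "b = 0"
    proof (rule ccontr)
      assume "b \<noteq> 0"
      then show False using q[of "- (c + 1) / (2 * b)"] True ac by (simp add: field_simps)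
    qed
    then show ?thesis using True by (simp add: a_def b_def)
  next
    case False
    then have "a > 0" using ac by simp
    have "0 \<le> c + 2 * (- b / a) * b + (- b / a)\<^sup>2 * a" by (rule q)
    also have "\<dots> = c - b\<^sup>2 / a" using False by (simp add: field_simps power2_eq_square)
    finally have "b\<^sup>2 \<le> c * a" using \<open>a > 0\<close> by (simp add: field_simps)
    then show ?thesis by (simp add: a_def b_def c_def)
  qed
qed

text \<open>Cauchy-Schwarz against the vector \<open>M v\<close>.\<close>

lemma psd_mat_null_vec:
  assumes "psd_mat n M" and v: "v \<in> carrier_vec n" and "v \<bullet> (M *\<^sub>v v) = 0"
  shows "M *\<^sub>v v = 0\<^sub>v n"
proof -
  have M: "M \<in> carrier_mat n n" using assms by (auto simp: psd_mat_def)
  then have "((M *\<^sub>v v) \<bullet> (M *\<^sub>v v))\<^sup>2 \<le> 0"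
    using psd_mat_Cauchy_Schwarz[OF assms(1) _ v, of "M *\<^sub>v v"] assms(3) v by simp
  then show ?thesis using M v by (intro scalar_prod_self_eq_0) auto
qed

lemma pd_mat_imp_psd_mat:
  assumes "pd_mat n M" shows "psd_mat n M"
proof -
  have "0 \<le> v \<bullet> (M *\<^sub>v v)" if "v \<in> carrier_vec n" for v
    using assms that by (cases "v = 0\<^sub>v n") (auto simp: pd_mat_def intro: less_imp_le)
  then show ?thesis using assms by (auto simp: psd_mat_def pd_mat_def)
qed

lemma pd_mat_injective:
  assumes "pd_mat n M" "v \<in> carrier_vec n" "M *\<^sub>v v = 0\<^sub>v n"
  shows "v = 0\<^sub>v n"
  using assms by (fastforce simp: pd_mat_def)

lemma psd_mat_congruence:
  assumes "psd_mat n M" and K: "K \<in> carrier_mat m n"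
  shows "psd_mat m (K * M * K\<^sup>T)"
proof -
  have M: "M \<in> carrier_mat n n" "M\<^sup>T = M" using assms by (auto simp: psd_mat_def)
  have "(K * M * K\<^sup>T)\<^sup>T = K * (M\<^sup>T * K\<^sup>T)"
    using M(1) K by (simp del: assoc_mult_mat add: transpose_mult[of _ m n _ m] transpose_mult[of _ m n _ n])
  also have "\<dots> = K * M * K\<^sup>T" using M K by (simp add: assoc_mult_mat[of _ m n _ n _ m])
  finally have sym: "(K * M * K\<^sup>T)\<^sup>T = K * M * K\<^sup>T" .
  have "0 \<le> v \<bullet> (K * M * K\<^sup>T *\<^sub>v v)" if v: "v \<in> carrier_vec m" for v
  proof -
    have "v \<bullet> (K * M * K\<^sup>T *\<^sub>v v) = v \<bullet> (K *\<^sub>v (M *\<^sub>v (K\<^sup>T *\<^sub>v v)))"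
      using M(1) K v by (simp add: assoc_mult_mat_vec[of _ m n _ m] assoc_mult_mat_vec[of _ m n _ n])
    also have "\<dots> = (K\<^sup>T *\<^sub>v v) \<bullet> (M *\<^sub>v (K\<^sup>T *\<^sub>v v))"
      using M(1) K v by (subst transpose_vec_mult_scalar[OF K]) auto
    also have "\<dots> \<ge> 0" using assms(1) K v by (auto simp: psd_mat_def)
    finally show ?thesis .
  qed
  then show ?thesis using sym M K by (auto simp: psd_mat_def)
qed

lemma mult_mat_vec_add3:
  assumes A: "A \<in> carrier_mat m n" and x: "x \<in> carrier_vec n" and y: "y \<in> carrier_vec n"
    and z: "z \<in> carrier_vec n"
  shows "(A :: real mat) *\<^sub>v (x + y + z) = A *\<^sub>v x + A *\<^sub>v y + A *\<^sub>v z"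
  using mult_add_distrib_mat_vec[OF A _ z, of "x + y"] mult_add_distrib_mat_vec[OF A x y] x y by simp

section \<open>Square roots of positive definite matrices and ellipsoids\<close>

text \<open>The characteristic polynomial has a complex root \<open>z\<close> with eigenvector \<open>a + i b\<close>. Comparing
  \<open>b \<bullet> A a\<close> with \<open>a \<bullet> A b\<close> gives \<open>Im z (a \<bullet> a + b \<bullet> b) = 0\<close>, so \<open>z\<close> is real and \<open>a\<close> or \<open>b\<close> is a real
  eigenvector.\<close>

lemma symmetric_mat_eigenvector:
  assumes A: "(A :: real mat) \<in> carrier_mat n n" "A\<^sup>T = A" and n: "0 < n"
  obtains \<mu> v where "v \<in> carrier_vec n" "v \<bullet> v = 1" "A *\<^sub>v v = \<mu> \<cdot>\<^sub>v v"
proof -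
  define C where "C = map_mat complex_of_real A"
  have C: "C \<in> carrier_mat n n" using A by (simp add: C_def)
  have "degree (char_poly C) > 0" using degree_monic_char_poly[OF C] n by auto
  then have "\<not> constant (poly (char_poly C))" by (simp add: constant_degree)
  from fundamental_theorem_of_algebra[OF this] obtain z where "poly (char_poly C) z = 0" by blast
  then have "eigenvalue C z" using eigenvalue_root_char_poly[OF C] by blast
  then obtain x where x: "x \<in> carrier_vec n" "x \<noteq> 0\<^sub>v n" "C *\<^sub>v x = z \<cdot>\<^sub>v x"
    using C by (auto simp: eigenvalue_def eigenvector_def)
  define a where "a = map_vec Re x"
  define b where "b = map_vec Im x"
  have ab: "a \<in> carrier_vec n" "b \<in> carrier_vec n" using x by (auto simp: a_def b_def)
  have row: "(\<Sum>j<n. complex_of_real (A $$ (i, j)) * x $ j) = z * x $ i" if "i < n" for i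
  proof -
    have "(C *\<^sub>v x) $ i = z * x $ i" using x that by simp
    then show ?thesis using A x that C by (simp add: scalar_prod_def C_def atLeast0LessThan)
  qed
  have Aa: "A *\<^sub>v a = Re z \<cdot>\<^sub>v a + (- Im z) \<cdot>\<^sub>v b"
  proof
    fix i assume "i < dim_vec (Re z \<cdot>\<^sub>v a + (- Im z) \<cdot>\<^sub>v b)"
    then have i: "i < n" using ab by simp
    from arg_cong[OF row[OF i], of Re]
    show "(A *\<^sub>v a) $ i = (Re z \<cdot>\<^sub>v a + (- Im z) \<cdot>\<^sub>v b) $ i"
      using A x i by (simp add: scalar_prod_def a_def b_def atLeast0LessThan)
  qed (use A ab in auto)
  have Ab: "A *\<^sub>v b = Im z \<cdot>\<^sub>v a + Re z \<cdot>\<^sub>v b"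
  proof
    fix i assume "i < dim_vec (Im z \<cdot>\<^sub>v a + Re z \<cdot>\<^sub>v b)"
    then have i: "i < n" using ab by simp
    from arg_cong[OF row[OF i], of Im]
    show "(A *\<^sub>v b) $ i = (Im z \<cdot>\<^sub>v a + Re z \<cdot>\<^sub>v b) $ i"
      using A x i by (simp add: scalar_prod_def a_def b_def atLeast0LessThan)
  qed (use A ab in auto)
  have "b \<bullet> (A *\<^sub>v a) = a \<bullet> (A *\<^sub>v b)" by (rule scalar_prod_symmetric_mat[OF A ab(2,1)])
  then have "Im z * (a \<bullet> a + b \<bullet> b) = 0"
    unfolding Aa Ab using ab comm_scalar_prod[OF ab]
    by (simp add: scalar_prod_add_distrib[of _ n] algebra_simps)
  moreover have nz: "a \<noteq> 0\<^sub>v n \<or> b \<noteq> 0\<^sub>v n"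
  proof (rule ccontr)
    assume "\<not> ?thesis"
    then have ab0: "a = 0\<^sub>v n" "b = 0\<^sub>v n" by auto
    have "x $ i = 0" if "i < n" for i
    proof -
      have "Re (x $ i) = a $ i" "Im (x $ i) = b $ i" using x that by (auto simp: a_def b_def)
      then show ?thesis using ab0 that by (simp add: complex_eq_iff)
    qed
    then have "x = 0\<^sub>v n" using x(1) by auto
    then show False using x(2) by simp
  qed
  then have "a \<bullet> a + b \<bullet> b \<noteq> 0"
    using scalar_prod_self_nonneg[of a] scalar_prod_self_nonneg[of b]
      scalar_prod_self_eq_0[OF ab(1)] scalar_prod_self_eq_0[OF ab(2)] by linarith
  ultimately have "Im z = 0" by simp
  then have ev: "A *\<^sub>v a = Re z \<cdot>\<^sub>v a" "A *\<^sub>v b = Re z \<cdot>\<^sub>v b" using Aa Ab ab by auto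
  then obtain c where c: "c \<in> carrier_vec n" "c \<noteq> 0\<^sub>v n" "A *\<^sub>v c = Re z \<cdot>\<^sub>v c"
    using nz ab by blast
  define r where "r = sqrt (c \<bullet> c)"
  have "c \<bullet> c \<noteq> 0" using scalar_prod_self_eq_0[OF c(1)] c(2) by blast
  then have r: "r \<noteq> 0" "c \<bullet> c = r * r"
    using scalar_prod_self_nonneg[of c] by (auto simp: r_def)
  show ?thesis
  proof
    show "(1 / r) \<cdot>\<^sub>v c \<in> carrier_vec n" using c by simp
    show "((1 / r) \<cdot>\<^sub>v c) \<bullet> ((1 / r) \<cdot>\<^sub>v c) = 1" using c r by simp
    show "A *\<^sub>v ((1 / r) \<cdot>\<^sub>v c) = Re z \<cdot>\<^sub>v ((1 / r) \<cdot>\<^sub>v c)"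
      using mult_mat_vec[OF A(1) c(1), of "1 / r"] c(3) by (simp add: smult_smult_assoc)
  qed
qed

text \<open>\<open>U\<close> is the reflection in the hyperplane orthogonal to \<open>v - e\<^sub>0\<close>.\<close>

lemma Householder_reflection:
  assumes v: "(v :: real vec) \<in> carrier_vec n" "v \<bullet> v = 1" and n: "0 < n"
  obtains U where "U \<in> carrier_mat n n" "U\<^sup>T = U" "U * U = 1\<^sub>m n" "U *\<^sub>v unit_vec n 0 = v"
proof (cases "v = unit_vec n 0")
  case True
  show ?thesis by (rule that[of "1\<^sub>m n"]) (use True in auto)
next
  case False
  define h where "h i = v $ i - (if i = 0 then 1 else 0)" for i
  define s where "s = (\<Sum>i<n. h i * h i)"
  have vv: "(\<Sum>i<n. v $ i * v $ i) = 1" using v by (simp add: scalar_prod_def atLeast0LessThan)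
  have "s = (\<Sum>i<n. v $ i * v $ i) + (\<Sum>i<n. if i = 0 then 1 - 2 * v $ i else 0)"
    unfolding s_def h_def sum.distrib[symmetric] by (rule sum.cong) (auto simp: algebra_simps)
  also have "\<dots> = 2 - 2 * v $ 0" using n vv by simp
  finally have s: "s = 2 - 2 * v $ 0" .
  have "s \<noteq> 0"
  proof
    assume "s = 0"
    then have "\<forall>i\<in>{..<n}. h i * h i = 0"
      unfolding s_def by (subst (asm) sum_nonneg_eq_0_iff) auto
    then have "v = unit_vec n 0" using v n by (intro eq_vecI) (auto simp: h_def unit_vec_def)
    then show False using False by simp
  qed
  define U where "U = mat n n (\<lambda>(i, j). (if i = j then 1 else 0) - 2 / s * (h i * h j))"
  have U: "U \<in> carrier_mat n n" by (simp add: U_def)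
  show ?thesis
  proof (rule that[OF U])
    show "U\<^sup>T = U" by (rule eq_matI) (auto simp: U_def)
    show "U * U = 1\<^sub>m n"
    proof (rule eq_matI)
      fix i j assume "i < dim_row (1\<^sub>m n)" "j < dim_col (1\<^sub>m n)"
      then have ij: "i < n" "j < n" by auto
      have scale: "(\<Sum>k<n. c * (h k * h k)) = c * s" for c
        unfolding s_def sum_distrib_left ..
      have total: "(\<Sum>k<n. (if k = i then p else 0) - (if k = j then q else 0) + c * (h k * h k))
          = p - q + c * s" for p q c
        using ij by (simp add: sum.distrib sum_subtractf scale)
      have "(U * U) $$ (i, j) = (\<Sum>k<n. ((if i = k then 1 else 0) - 2 / s * (h i * h k)) *
          ((if k = j then 1 else 0) - 2 / s * (h k * h j)))"
        using ij by (simp add: U_def scalar_prod_def atLeast0LessThan)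
      also have "\<dots> = (\<Sum>k<n. (if k = i then (if i = j then 1 else 0) - 2 / s * (h i * h j) else 0)
          - (if k = j then 2 / s * (h i * h j) else 0) + 4 / (s * s) * h i * h j * (h k * h k))"
        by (rule sum.cong) (auto simp: algebra_simps)
      also have "\<dots> = ((if i = j then 1 else 0) - 2 / s * (h i * h j)) - 2 / s * (h i * h j)
          + 4 / (s * s) * h i * h j * s"
        by (rule total)
      also have "\<dots> = 1\<^sub>m n $$ (i, j)" using ij \<open>s \<noteq> 0\<close> by (simp add: field_simps)
      finally show "(U * U) $$ (i, j) = 1\<^sub>m n $$ (i, j)" .
    qed (use U in auto)
    show "U *\<^sub>v unit_vec n 0 = v"
    proof
      fix i assume "i < dim_vec v"
      then have i: "i < n" using v by simp
      have "(U *\<^sub>v unit_vec n 0) $ i = U $$ (i, 0)"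
        using i n U by (simp add: scalar_prod_right_unit)
      also have "\<dots> = (if i = 0 then 1 else 0) - 2 / s * (h i * (v $ 0 - 1))"
        using i n by (simp add: U_def h_def)
      also have "\<dots> = (if i = 0 then 1 else 0) + h i * (2 - 2 * v $ 0) / s"
        using \<open>s \<noteq> 0\<close> by (simp add: field_simps)
      also have "\<dots> = v $ i" using \<open>s \<noteq> 0\<close> s by (simp add: h_def)
      finally show "(U *\<^sub>v unit_vec n 0) $ i = v $ i" .
    qed (use U v in auto)
  qed
qed

text \<open>Deflation: a Householder reflection \<open>U\<close> that moves \<open>e\<^sub>0\<close> to an eigenvector makes \<open>U A U\<close> block
  diagonal with blocks of sizes \<open>1\<close> and \<open>n\<close>, and the lower block has a root by induction.\<close>

lemma psd_sqrt_exists: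
  "psd_mat n A \<Longrightarrow> \<exists>R. psd_mat n R \<and> R * R = A"
proof (induction n arbitrary: A)
  case 0
  then have "A \<in> carrier_mat 0 0" by (simp add: psd_mat_def)
  then have "A * A = A" by auto
  then show ?case using 0 by blast
next
  case (Suc n)
  let ?m = "Suc n"
  have A: "A \<in> carrier_mat ?m ?m" "A\<^sup>T = A" using Suc.prems by (auto simp: psd_mat_def)
  obtain \<mu> v where v: "v \<in> carrier_vec ?m" "v \<bullet> v = 1" "A *\<^sub>v v = \<mu> \<cdot>\<^sub>v v"
    by (rule symmetric_mat_eigenvector[OF A zero_less_Suc])
  have "0 \<le> v \<bullet> (A *\<^sub>v v)" using Suc.prems v by (auto simp: psd_mat_def)
  then have "0 \<le> \<mu>" using v by simp
  obtain U where U: "U \<in> carrier_mat ?m ?m" "U\<^sup>T = U" "U * U = 1\<^sub>m ?m" "U *\<^sub>v unit_vec ?m 0 = v"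
    using Householder_reflection[OF v(1,2)] by auto
  define B where "B = U * A * U"
  have B: "psd_mat ?m B" using psd_mat_congruence[OF Suc.prems U(1)] U(2) by (simp add: B_def)
  then have Bc: "B \<in> carrier_mat ?m ?m" "B\<^sup>T = B" by (auto simp: psd_mat_def)
  have "B *\<^sub>v unit_vec ?m 0 = U *\<^sub>v (A *\<^sub>v (U *\<^sub>v unit_vec ?m 0))"
    using A U(1) unfolding B_def
    by (simp del: assoc_mult_mat add: assoc_mult_mat_vec[of _ ?m ?m _ ?m])
  also have "\<dots> = \<mu> \<cdot>\<^sub>v (U *\<^sub>v (U *\<^sub>v unit_vec ?m 0))"
    using U(1) v by (simp add: U(4) mult_mat_vec[of U ?m ?m])
  also have "\<dots> = \<mu> \<cdot>\<^sub>v unit_vec ?m 0"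
    using U(1,3) assoc_mult_mat_vec[OF U(1) U(1), of "unit_vec ?m 0"] by simp
  finally have Be: "B *\<^sub>v unit_vec ?m 0 = \<mu> \<cdot>\<^sub>v unit_vec ?m 0" .
  have Bi0: "B $$ (i, 0) = (if i = 0 then \<mu> else 0)" if "i < ?m" for i
    using arg_cong[OF Be, of "\<lambda>x. x $ i"] that Bc by (simp add: scalar_prod_right_unit)
  have B0j: "B $$ (0, j) = (if j = 0 then \<mu> else 0)" if "j < ?m" for j
  proof -
    have "B $$ (0, j) = B\<^sup>T $$ (j, 0)" using that Bc(1) by simp
    then show ?thesis using Bi0[OF that] Bc(2) by simp
  qed
  define B' where "B' = mat n n (\<lambda>(i, j). B $$ (Suc i, Suc j))"
  have B'c: "B' \<in> carrier_mat n n" by (simp add: B'_def)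
  define D where "D x X = four_block_mat (mat 1 1 (\<lambda>_. x)) (0\<^sub>m 1 n) (0\<^sub>m n 1) X"
    for x :: real and X
  have D: "D x X \<in> carrier_mat ?m ?m" if "X \<in> carrier_mat n n" for x X
    using that by (auto simp: D_def)
  have BD: "B = D \<mu> B'"
  proof (rule eq_matI)
    fix i j assume "i < dim_row (D \<mu> B')" "j < dim_col (D \<mu> B')"
    then have ij: "i < ?m" "j < ?m" using D[OF B'c, of \<mu>] by auto
    then show "B $$ (i, j) = D \<mu> B' $$ (i, j)"
      using Bi0[of i] B0j[of j] by (cases i; cases j) (auto simp: D_def B'_def)
  qed (use Bc D[OF B'c, of \<mu>] in auto)
  have form: "(a @\<^sub>v b) \<bullet> (D x X *\<^sub>v (a @\<^sub>v b)) = x * (a $ 0 * a $ 0) + b \<bullet> (X *\<^sub>v b)"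
    if X: "X \<in> carrier_mat n n" and a: "a \<in> carrier_vec 1" and b: "b \<in> carrier_vec n" for x X a b
  proof -
    have "D x X *\<^sub>v (a @\<^sub>v b) = mat 1 1 (\<lambda>_. x) *\<^sub>v a @\<^sub>v X *\<^sub>v b"
      unfolding D_def by (rule mult_mat_vec_split[OF _ X a b]) simp
    moreover have "(a @\<^sub>v b) \<bullet> (mat 1 1 (\<lambda>_. x) *\<^sub>v a @\<^sub>v X *\<^sub>v b)
        = a \<bullet> (mat 1 1 (\<lambda>_. x) *\<^sub>v a) + b \<bullet> (X *\<^sub>v b)"
      by (rule scalar_prod_append[of _ 1 _ n]) (use X a b in \<open>auto intro!: carrier_vecI\<close>)
    ultimately show ?thesis using a by (simp add: scalar_prod_def)
  qed
  have "psd_mat n B'"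
    unfolding psd_mat_def
  proof (intro conjI ballI)
    show "B'\<^sup>T = B'"
    proof (rule eq_matI)
      fix i j assume "i < dim_row B'" "j < dim_col B'"
      then have ij: "i < n" "j < n" by (auto simp: B'_def)
      then have "B $$ (Suc j, Suc i) = B\<^sup>T $$ (Suc i, Suc j)" using Bc(1) by simp
      then show "B'\<^sup>T $$ (i, j) = B' $$ (i, j)" using ij Bc(2) by (simp add: B'_def)
    qed (auto simp: B'_def)
    fix b :: "real vec" assume b: "b \<in> carrier_vec n"
    then have "0\<^sub>v 1 @\<^sub>v b \<in> carrier_vec ?m"
      using append_carrier_vec[of "0\<^sub>v 1" 1 b n] by simp
    then have "0 \<le> (0\<^sub>v 1 @\<^sub>v b) \<bullet> (B *\<^sub>v (0\<^sub>v 1 @\<^sub>v b))" using B unfolding psd_mat_def by blast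
    then show "0 \<le> b \<bullet> (B' *\<^sub>v b)" unfolding BD using form[OF B'c _ b, of "0\<^sub>v 1" \<mu>] by simp
  qed (rule B'c)
  from Suc.IH[OF this] obtain R' where R': "psd_mat n R'" "R' * R' = B'" by blast
  then have R'c: "R' \<in> carrier_mat n n" "R'\<^sup>T = R'" by (auto simp: psd_mat_def)
  define E where "E = D (sqrt \<mu>) R'"
  have Ec: "E \<in> carrier_mat ?m ?m" using D[OF R'c(1)] by (simp add: E_def)
  have "psd_mat ?m E"
    unfolding psd_mat_def
  proof (intro conjI ballI)
    show "E\<^sup>T = E"
    proof (rule eq_matI)
      fix i j assume "i < dim_row E" "j < dim_col E"
      then have ij: "i < ?m" "j < ?m" using Ec by auto
      have "R' $$ (j - 1, i - 1) = R'\<^sup>T $$ (i - 1, j - 1)" if "i \<noteq> 0" "j \<noteq> 0"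
        using that ij R'c(1) by simp
      then show "E\<^sup>T $$ (i, j) = E $$ (i, j)" using ij R'c Ec by (simp add: E_def D_def)
    qed (use Ec in auto)
    fix x :: "real vec" assume x: "x \<in> carrier_vec ?m"
    define a where "a = vec_first x 1"
    define b where "b = vec_last x n"
    have ab: "a \<in> carrier_vec 1" "b \<in> carrier_vec n" by (auto simp: a_def b_def)
    have "x = a @\<^sub>v b" using x unfolding a_def b_def by (intro vec_first_last_append[symmetric]) simp
    moreover have "0 \<le> b \<bullet> (R' *\<^sub>v b)" using R' ab by (auto simp: psd_mat_def)
    ultimately show "0 \<le> x \<bullet> (E *\<^sub>v x)"
      unfolding E_def using form[OF R'c(1) ab] \<open>0 \<le> \<mu>\<close> by simp
  qed (rule Ec)
  have EE: "E * E = B"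
  proof -
    have "E * E = four_block_mat (mat 1 1 (\<lambda>_. sqrt \<mu>) * mat 1 1 (\<lambda>_. sqrt \<mu>) + 0\<^sub>m 1 n * 0\<^sub>m n 1)
      (mat 1 1 (\<lambda>_. sqrt \<mu>) * 0\<^sub>m 1 n + 0\<^sub>m 1 n * R')
      (0\<^sub>m n 1 * mat 1 1 (\<lambda>_. sqrt \<mu>) + R' * 0\<^sub>m n 1) (0\<^sub>m n 1 * 0\<^sub>m 1 n + R' * R')"
      unfolding E_def D_def by (rule mult_four_block_mat) (use R'c in auto)
    also have "mat 1 1 (\<lambda>_. sqrt \<mu>) * mat 1 1 (\<lambda>_. sqrt \<mu>) + 0\<^sub>m 1 n * 0\<^sub>m n 1 = mat 1 1 (\<lambda>_. \<mu>)"
      using \<open>0 \<le> \<mu>\<close> by (intro eq_matI) (auto simp: scalar_prod_def)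
    finally show ?thesis using R'(2) R'c(1) B'c by (simp add: BD D_def)
  qed
  have "psd_mat ?m (U * E * U)"
    using psd_mat_congruence[OF \<open>psd_mat ?m E\<close> U(1)] U(2) by simp
  moreover have "(U * E * U) * (U * E * U) = A"
  proof -
    have cancel: "U * (U * X) = X" if "X \<in> carrier_mat ?m ?m" for X
      using that U(1,3) assoc_mult_mat[OF U(1) U(1) that] by simp
    have "(U * E * U) * (U * E * U) = U * (E * (U * (U * (E * U))))"
      using U(1) Ec by (simp add: assoc_mult_mat[of _ ?m ?m _ ?m _ ?m])
    also have "\<dots> = U * (E * (E * U))" using U(1) Ec by (simp add: cancel del: assoc_mult_mat)
    also have "\<dots> = U * (B * U)" using U(1) Ec EE by (simp add: assoc_mult_mat[of _ ?m ?m _ ?m _ ?m, symmetric] del: assoc_mult_mat)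
    also have "\<dots> = U * (U * (A * (U * U)))"
      using U(1) A(1) by (simp add: B_def assoc_mult_mat[of _ ?m ?m _ ?m _ ?m])
    also have "\<dots> = A" using U A(1) by (simp add: cancel del: assoc_mult_mat)
    finally show ?thesis .
  qed
  ultimately show ?case by blast
qed

text \<open>With \<open>D = R - S\<close> one has \<open>R D + D S = R R - S S = 0\<close>. Multiplying by \<open>D\<close> and taking the trace
  gives \<open>tr (D R D) + tr (D S D) = 0\<close>. Both traces are sums of nonnegative values of the quadratic
  forms of \<open>R\<close> and \<open>S\<close> at the columns of \<open>D\<close>, so \<open>R D = 0\<close>, and \<open>R\<close> is injective because
  \<open>R R\<close> is.\<close>

lemma psd_sqrt_unique:
  assumes R: "psd_mat n R" and S: "psd_mat n S" and eq: "R * R = S * S" and pd: "pd_mat n (R * R)"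
  shows "R = S"
proof -
  have Rc: "R \<in> carrier_mat n n" "R\<^sup>T = R" and Sc: "S \<in> carrier_mat n n" "S\<^sup>T = S"
    using R S by (auto simp: psd_mat_def)
  define D where "D = R - S"
  have Dc: "D \<in> carrier_mat n n" using Rc Sc by (simp add: D_def minus_carrier_mat)
  have DT: "D\<^sup>T = D" using Rc Sc transpose_minus[OF Rc(1) Sc(1)] by (simp add: D_def)
  have trace_swap: "(\<Sum>i<n. (X * Y) $$ (i, i)) = (\<Sum>i<n. (Y * X) $$ (i, i))"
    if "X \<in> carrier_mat n n" "Y \<in> carrier_mat n n" for X Y :: "real mat"
    using that by (simp add: scalar_prod_def atLeast0LessThan mult.commute) (rule sum.swap)
  have trace_form: "(\<Sum>i<n. (D * (M * D)) $$ (i, i)) = (\<Sum>i<n. col D i \<bullet> (M *\<^sub>v col D i))"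
    if M: "M \<in> carrier_mat n n" for M
  proof (rule sum.cong)
    fix i assume "i \<in> {..<n}"
    then have i: "i < n" by simp
    have "row D i = col D\<^sup>T i" using Dc i by simp
    then show "(D * (M * D)) $$ (i, i) = col D i \<bullet> (M *\<^sub>v col D i)"
      using Dc M i by (simp add: DT del: col_transpose)
  qed simp
  have "R * D + D * S = 0\<^sub>m n n"
  proof -
    have "R * D = R * R - R * S" "D * S = R * S - S * S"
      using Rc Sc by (auto simp: D_def mult_minus_distrib_mat minus_mult_distrib_mat)
    then show ?thesis using Rc Sc eq by (auto intro!: eq_matI)
  qed
  moreover have "D * (R * D + D * S) = D * (R * D) + D * (D * S)"
    by (rule mult_add_distrib_mat) (use Rc(1) Sc(1) Dc in auto)
  ultimately have DRD: "D * (R * D) + D * (D * S) = 0\<^sub>m n n" using Dc by simp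
  have "(D * (R * D)) $$ (i, i) + (D * (D * S)) $$ (i, i) = 0" if "i < n" for i
  proof -
    have "(D * (R * D) + D * (D * S)) $$ (i, i) = (D * (R * D)) $$ (i, i) + (D * (D * S)) $$ (i, i)"
      by (rule index_add_mat(1)) (use Dc Sc(1) that in auto)
    then show ?thesis unfolding DRD using that by simp
  qed
  then have "(\<Sum>i<n. (D * (R * D)) $$ (i, i) + (D * (D * S)) $$ (i, i)) = 0"
    by (intro sum.neutral) auto
  then have "(\<Sum>i<n. (D * (R * D)) $$ (i, i)) + (\<Sum>i<n. (D * (S * D)) $$ (i, i)) = 0"
    using trace_swap[of D "D * S"] Dc Sc by (simp add: sum.distrib)
  then have "(\<Sum>i<n. col D i \<bullet> (R *\<^sub>v col D i)) + (\<Sum>i<n. col D i \<bullet> (S *\<^sub>v col D i)) = 0"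
    by (simp only: trace_form[OF Rc(1)] trace_form[OF Sc(1)])
  moreover have nonneg: "0 \<le> col D i \<bullet> (R *\<^sub>v col D i)" "0 \<le> col D i \<bullet> (S *\<^sub>v col D i)"
    if "i < n" for i
    using R S Dc that by (auto simp: psd_mat_def)
  moreover have "0 \<le> (\<Sum>i<n. col D i \<bullet> (R *\<^sub>v col D i))" "0 \<le> (\<Sum>i<n. col D i \<bullet> (S *\<^sub>v col D i))"
    by (auto intro!: sum_nonneg nonneg)
  ultimately have "(\<Sum>i<n. col D i \<bullet> (R *\<^sub>v col D i)) = 0" by linarith
  then have zero: "\<forall>i\<in>{..<n}. col D i \<bullet> (R *\<^sub>v col D i) = 0"
    by (subst (asm) sum_nonneg_eq_0_iff) (auto intro: nonneg)
  have "col D i = 0\<^sub>v n" if "i < n" for i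
  proof -
    have ci: "col D i \<in> carrier_vec n" using Dc that by auto
    have "R *\<^sub>v col D i = 0\<^sub>v n" using psd_mat_null_vec[OF R ci] zero that by simp
    then have "R * R *\<^sub>v col D i = 0\<^sub>v n"
      using assoc_mult_mat_vec[OF Rc(1) Rc(1) ci] Rc(1) by (auto intro!: eq_vecI)
    then show ?thesis by (rule pd_mat_injective[OF pd ci])
  qed
  then have D0: "D $$ (i, j) = 0" if "i < n" "j < n" for i j
    using that Dc by (metis carrier_matD index_col index_zero_vec(1))
  show ?thesis
  proof (rule eq_matI)
    fix i j assume "i < dim_row S" "j < dim_col S"
    then show "R $$ (i, j) = S $$ (i, j)" using D0[of i j] Rc Sc by (simp add: D_def)
  qed (use Rc Sc in auto)
qed

lemma mat_sqrt_square:
  assumes "pd_mat n M"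
  shows "psd_mat n (mat_sqrt M)" "mat_sqrt M * mat_sqrt M = M"
proof -
  have n: "dim_row M = n" using assms by (auto simp: pd_mat_def)
  obtain R where R: "psd_mat n R \<and> R * R = M"
    using psd_sqrt_exists[OF pd_mat_imp_psd_mat[OF assms]] by blast
  have "psd_mat n (mat_sqrt M) \<and> mat_sqrt M * mat_sqrt M = M"
    unfolding mat_sqrt_def n
  proof (rule theI[where P = "\<lambda>R. psd_mat n R \<and> R * R = M", OF R])
    fix S assume "psd_mat n S \<and> S * S = M"
    then show "S = R" using psd_sqrt_unique[of n S R] R assms by auto
  qed
  then show "psd_mat n (mat_sqrt M)" "mat_sqrt M * mat_sqrt M = M" by auto
qed

lemma eucl_norm_mat_sqrt:
  assumes M: "pd_mat n M" and v: "v \<in> carrier_vec n"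
  shows "eucl_norm (mat_sqrt M *\<^sub>v v) = sqrt (v \<bullet> (M *\<^sub>v v))"
proof -
  let ?R = "mat_sqrt M"
  have R: "?R \<in> carrier_mat n n" "?R\<^sup>T = ?R" using mat_sqrt_square(1)[OF M] by (auto simp: psd_mat_def)
  have "(?R *\<^sub>v v) \<bullet> (?R *\<^sub>v v) = v \<bullet> (?R *\<^sub>v (?R *\<^sub>v v))"
    using transpose_vec_mult_scalar[OF R(1), of "?R *\<^sub>v v" v] R v by simp
  also have "\<dots> = v \<bullet> (M *\<^sub>v v)"
    using assoc_mult_mat_vec[OF R(1) R(1) v] mat_sqrt_square(2)[OF M] by simp
  finally show ?thesis by (simp add: eucl_norm_def)
qed

lemma pd_mat_minv:
  assumes "pd_mat n M"
  shows "minv M \<in> carrier_mat n n" "M * minv M = 1\<^sub>m n" "minv M * M = 1\<^sub>m n" "(minv M)\<^sup>T = minv M"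
proof -
  have M: "M \<in> carrier_mat n n" "M\<^sup>T = M" using assms by (auto simp: pd_mat_def)
  note inv = minv_inverse[OF M(1) pd_mat_injective[OF assms]]
  show "minv M \<in> carrier_mat n n" "M * minv M = 1\<^sub>m n" "minv M * M = 1\<^sub>m n"
    using inv by auto
  have "(minv M)\<^sup>T * M = 1\<^sub>m n"
    using transpose_mult[OF M(1) inv(1)] inv(2) M(2) by simp
  then have "minv M = (minv M)\<^sup>T * M * minv M" using inv(1) by simp
  also have "\<dots> = (minv M)\<^sup>T * (M * minv M)"
    by (rule assoc_mult_mat) (use inv(1) M(1) in auto)
  also have "\<dots> = (minv M)\<^sup>T" using inv(1,2) by simp
  finally show "(minv M)\<^sup>T = minv M" ..
qed

text \<open>Cauchy-Schwarz for \<open>a\<close> and \<open>M\<^sup>-\<^sup>1 z\<close> in the form of \<open>M\<close>. The right-hand side is in fact the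
  support function of the ellipsoid \<open>z \<bullet> M\<^sup>-\<^sup>1 z \<le> 1\<close> at \<open>a\<close>.\<close>

lemma ellipsoid_support:
  assumes M: "pd_mat n M" and a: "a \<in> carrier_vec n" and z: "z \<in> carrier_vec n"
    and le: "z \<bullet> (minv M *\<^sub>v z) \<le> 1"
  shows "a \<bullet> z \<le> eucl_norm (mat_sqrt M *\<^sub>v a)"
proof -
  note inv = pd_mat_minv[OF M]
  have Mc: "M \<in> carrier_mat n n" using M by (auto simp: pd_mat_def)
  define y where "y = minv M *\<^sub>v z"
  have y: "y \<in> carrier_vec n" using inv z by (simp add: y_def)
  have My: "M *\<^sub>v y = z" using assoc_mult_mat_vec[OF Mc inv(1) z] inv(2) z by (simp add: y_def)
  have "y \<bullet> z = z \<bullet> y" by (rule comm_scalar_prod[OF y z])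
  then have "(a \<bullet> z)\<^sup>2 \<le> (a \<bullet> (M *\<^sub>v a)) * (z \<bullet> y)"
    using psd_mat_Cauchy_Schwarz[OF pd_mat_imp_psd_mat[OF M] a y] My by simp
  also have "\<dots> \<le> a \<bullet> (M *\<^sub>v a)"
    using le pd_mat_imp_psd_mat[OF M] a by (intro mult_left_le) (auto simp: y_def psd_mat_def)
  finally have "a \<bullet> z \<le> sqrt (a \<bullet> (M *\<^sub>v a))" by (rule real_le_rsqrt)
  then show ?thesis by (simp add: eucl_norm_mat_sqrt[OF M a])
qed

lemma ellipsoid_row_bound:
  assumes M: "pd_mat n M" and A: "A \<in> carrier_mat m n" and i: "i < m"
    and z: "z \<in> carrier_vec n" "z \<bullet> (minv M *\<^sub>v z) \<le> 1"
  shows "(A *\<^sub>v z) $ i \<le> eucl_norm (mat_sqrt M *\<^sub>v (A\<^sup>T *\<^sub>v unit_vec m i))"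
proof -
  let ?e = "unit_vec m i :: real vec"
  have AT: "A\<^sup>T \<in> carrier_mat n m" using A by simp
  have Ae: "A\<^sup>T *\<^sub>v ?e \<in> carrier_vec n" by (rule mult_mat_vec_carrier[OF AT]) simp
  have "(A *\<^sub>v z) $ i = ?e \<bullet> (A *\<^sub>v z)"
    using scalar_prod_left_unit[OF mult_mat_vec_carrier[OF A z(1)] i] by simp
  also have "\<dots> = (A\<^sup>T *\<^sub>v ?e) \<bullet> z"
    by (rule transpose_vec_mult_scalar[OF A z(1), symmetric]) simp
  also have "\<dots> \<le> eucl_norm (mat_sqrt M *\<^sub>v (A\<^sup>T *\<^sub>v ?e))" by (rule ellipsoid_support[OF M Ae z])
  finally show ?thesis .
qed

section \<open>Positions in stacked trajectories\<close>

lemma offset_less: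
  fixes d :: "nat \<Rightarrow> nat"
  assumes "i < N" "k < d i"
  shows "(\<Sum>j<i. d j) + k < (\<Sum>j<N. d j)"
proof -
  have "(\<Sum>j<i. d j) + k < (\<Sum>j<Suc i. d j)" using assms by simp
  also have "\<dots> \<le> (\<Sum>j<N. d j)" using assms by (intro sum_mono2) auto
  finally show ?thesis .
qed

lemma offset_inj:
  fixes d :: "nat \<Rightarrow> nat"
  assumes "k < d i" "k' < d i'" and eq: "(\<Sum>j<i. d j) + k = (\<Sum>j<i'. d j) + k'"
  shows "i = i' \<and> k = k'"
proof -
  have "\<not> i < i'" using offset_less[of i i' k d] assms by auto
  moreover have "\<not> i' < i" using offset_less[of i' i k' d] assms by auto
  ultimately have "i = i'" by simp
  then show ?thesis using eq by simp
qed

lemma offset_surj: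
  fixes d :: "nat \<Rightarrow> nat"
  assumes "a < (\<Sum>j<N. d j)"
  shows "\<exists>i<N. \<exists>k<d i. a = (\<Sum>j<i. d j) + k"
  using assms
proof (induction N)
  case (Suc N)
  show ?case
  proof (cases "a < (\<Sum>j<N. d j)")
    case True
    then show ?thesis using Suc.IH less_SucI by blast
  next
    case False
    then have "a - (\<Sum>j<N. d j) < d N" "a = (\<Sum>j<N. d j) + (a - (\<Sum>j<N. d j))"
      using Suc.prems by auto
    then show ?thesis by blast
  qed
qed simp

definition entries :: "(nat \<Rightarrow> nat) \<Rightarrow> nat \<Rightarrow> nat \<Rightarrow> (nat \<times> nat \<times> nat) set" where
  "entries d N m = {..<m} \<times> (SIGMA i:{..<N}. {..<d i})"

definition entry_pos :: "(nat \<Rightarrow> nat) \<Rightarrow> nat \<Rightarrow> nat \<times> nat \<times> nat \<Rightarrow> nat" where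
  "entry_pos d N = (\<lambda>(t, i, k). pos d N t i k)"

lemma pos_inj:
  assumes "i < N" "k < d i" "i' < N" "k' < d i'" and eq: "pos d N t i k = pos d N t' i' k'"
  shows "t = t' \<and> i = i' \<and> k = k'"
proof -
  let ?n = "\<Sum>j<N. d j"
  have o: "(\<Sum>j<i. d j) + k < ?n" "(\<Sum>j<i'. d j) + k' < ?n"
    using assms by (auto intro: offset_less)
  have "t * ?n + ((\<Sum>j<i. d j) + k) = t' * ?n + ((\<Sum>j<i'. d j) + k')"
    using eq by (simp add: pos_def add.assoc)
  moreover have "(s * ?n + a) div ?n = s" "(s * ?n + a) mod ?n = a" if "a < ?n" for s a
    using that div_mult_self3[of ?n s a] by (auto simp: add.commute[of _ a] div_add1_eq)
  ultimately have "t = t'" "(\<Sum>j<i. d j) + k = (\<Sum>j<i'. d j) + k'" using o by metis+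
  then show ?thesis using offset_inj assms(2,4) by blast
qed

text \<open>Time is the quotient of the position by the length of one time slice. This bijection turns sums
  over coordinates into sums over times, components and entries.\<close>

lemma bij_betw_entry_pos:
  "bij_betw (entry_pos d N) (entries d N m) {..<(\<Sum>j<N. d j) * m}"
proof (rule bij_betw_imageI)
  show "inj_on (entry_pos d N) (entries d N m)"
  proof (rule inj_onI)
    fix e e' assume "e \<in> entries d N m" "e' \<in> entries d N m" "entry_pos d N e = entry_pos d N e'"
    then show "e = e'"
      using pos_inj[of "fst (snd e)" N "snd (snd e)" d "fst (snd e')" "snd (snd e')" "fst e" "fst e'"]
      by (cases e; cases e') (simp add: entries_def entry_pos_def)
  qed
  let ?n = "\<Sum>j<N. d j"
  show "entry_pos d N ` entries d N m = {..<?n * m}"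
  proof (rule equalityI; rule subsetI)
    fix r assume "r \<in> entry_pos d N ` entries d N m"
    then obtain t i k where *: "t < m" "i < N" "k < d i" "r = pos d N t i k"
      by (auto simp: entries_def entry_pos_def)
    have "r < Suc t * ?n" using offset_less[of i N k d] * by (simp add: pos_def)
    also have "\<dots> \<le> m * ?n" using * by (intro mult_right_mono) auto
    finally show "r \<in> {..<?n * m}" by (simp add: mult.commute)
  next
    fix r assume "r \<in> {..<?n * m}"
    then have r: "r < ?n * m" by simp
    then have "0 < ?n" by (metis mult_is_0 not_gr_zero not_less_zero)
    then obtain i k where ik: "i < N" "k < d i" "r mod ?n = (\<Sum>j<i. d j) + k"
      using offset_surj[of "r mod ?n" d N] by auto
    have "r div ?n < m" using r by (simp add: less_mult_imp_div_less mult.commute)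
    moreover have "r = pos d N (r div ?n) i k" using ik(3) div_mult_mod_eq[of r ?n] by (simp add: pos_def add.assoc)
    ultimately show "r \<in> entry_pos d N ` entries d N m"
      using ik by (auto simp: entries_def entry_pos_def intro!: image_eqI[of _ _ "(r div ?n, i, k)"])
  qed
qed

lemma finite_entries [simp]: "finite (entries d N m)"
  by (simp add: entries_def)

lemma sum_entries:
  "(\<Sum>r<(\<Sum>j<N. d j) * m. f r) = (\<Sum>e\<in>entries d N m. f (entry_pos d N e))"
  by (rule sum.reindex_bij_betw[OF bij_betw_entry_pos, symmetric])

lemma pos_less:
  "t < m \<Longrightarrow> i < N \<Longrightarrow> k < d i \<Longrightarrow> pos d N t i k < (\<Sum>j<N. d j) * m"
  using bij_betw_apply[OF bij_betw_entry_pos[of d N m], of "(t, i, k)"]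
  by (simp add: entries_def entry_pos_def)

lemma pos_cases:
  assumes "r < (\<Sum>j<N. d j) * m"
  obtains t i k where "t < m" "i < N" "k < d i" "r = pos d N t i k"
proof -
  have "r \<in> entry_pos d N ` entries d N m"
    using assms bij_betw_imp_surj_on[OF bij_betw_entry_pos[of d N m]] by simp
  then show ?thesis by (rule imageE) (auto simp: entries_def entry_pos_def intro: that)
qed

abbreviation "xpos S \<equiv> pos (xdim S) (nsub S)"
abbreviation "upos S \<equiv> pos (udim S) (nsub S)"
abbreviation "xCpos S \<equiv> pos (xCdim S) (nsub S)"

lemma xpos_less: "t \<le> horizon S \<Longrightarrow> i < nsub S \<Longrightarrow> k < xdim S i \<Longrightarrow> xpos S t i k < Nx S"
  unfolding Nx_def by (rule pos_less) auto

lemma upos_less: "t < horizon S \<Longrightarrow> i < nsub S \<Longrightarrow> k < udim S i \<Longrightarrow> upos S t i k < Nu S"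
  unfolding Nu_def by (rule pos_less) auto

lemma xpos_cases:
  assumes "r < Nx S"
  obtains t i k where "t \<le> horizon S" "i < nsub S" "k < xdim S i" "r = xpos S t i k"
  using assms unfolding Nx_def by (rule pos_cases) (auto simp: less_Suc_eq_le)

lemma upos_cases:
  assumes "r < Nu S"
  obtains t i k where "t < horizon S" "i < nsub S" "k < udim S i" "r = upos S t i k"
  using assms unfolding Nu_def by (rule pos_cases)

lemma info_subset:
  assumes "valid_system S" and "i < nsub S"
  shows "Nset S i \<subseteq> {..<nsub S}" "Cset S i \<subseteq> {..<nsub S}" "Cset S i \<subseteq> Call S"
  using assms by (auto simp: valid_system_def Nset_def Cset_def VI_in_def Call_def)

lemma Call_subset: "valid_system S \<Longrightarrow> Call S \<subseteq> {..<nsub S}"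
  using info_subset(2) by (auto simp: Call_def)

lemma xCpos_less:
  assumes "valid_system S" "t \<le> horizon S" "j \<in> Call S" "k < xdim S j"
  shows "xCpos S t j k < NxC S"
  unfolding NxC_def using assms Call_subset[OF assms(1)]
  by (intro pos_less) (auto simp: xCdim_def)

lemma xCpos_cases:
  assumes "r < NxC S"
  obtains t j k where "t \<le> horizon S" "j \<in> Call S" "k < xdim S j" "r = xCpos S t j k"
proof -
  obtain t j k where *: "t < horizon S + 1" "j < nsub S" "k < xCdim S j" "r = xCpos S t j k"
    using assms unfolding NxC_def by (rule pos_cases)
  then have "j \<in> Call S" "k < xdim S j" by (simp_all add: xCdim_def split: if_splits)
  with * show ?thesis by (intro that) auto
qed

lemma projC_carrier: "projC S \<in> carrier_mat (NxC S) (Nx S)"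
  by (simp add: projC_def)

lemma index_projC:
  assumes S: "valid_system S" and t: "t \<le> horizon S" and j: "j \<in> Call S" and k: "k < xdim S j"
  shows "c < Nx S \<Longrightarrow> projC S $$ (xCpos S t j k, c) = (if c = xpos S t j k then 1 else 0)"
    and "r < NxC S \<Longrightarrow> projC S $$ (r, xpos S t j k) = (if r = xCpos S t j k then 1 else 0)"
proof -
  have jN: "j < nsub S" "k < xCdim S j" using Call_subset[OF S] j k by (auto simp: xCdim_def)
  have r: "xCpos S t j k < NxC S" by (rule xCpos_less[OF S t j k])
  have c: "xpos S t j k < Nx S" by (rule xpos_less[OF t jN(1) k])
  have dims: "j' < nsub S" "k' < xCdim S j'" if "j' \<in> Call S" "k' < xdim S j'" for j' k'
    using that Call_subset[OF S] by (auto simp: xCdim_def)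
  have injC: "t = t' \<and> j = j' \<and> k = k'"
    if "j' \<in> Call S" "k' < xdim S j'" "xCpos S t j k = xCpos S t' j' k'" for t' j' k'
    by (rule pos_inj[OF jN dims[OF that(1,2)] that(3)])
  have inj: "t = t' \<and> j = j' \<and> k = k'"
    if "j' \<in> Call S" "k' < xdim S j'" "xpos S t j k = xpos S t' j' k'" for t' j' k'
    by (rule pos_inj[OF jN(1) k dims(1)[OF that(1,2)] that(2,3)])
  have "(\<exists>t'\<le>horizon S. \<exists>j'\<in>Call S. \<exists>k'<xdim S j'. xCpos S t j k = xCpos S t' j' k' \<and> c = xpos S t' j' k')
      \<longleftrightarrow> c = xpos S t j k" for c
    using t j k injC by metis
  then show "c < Nx S \<Longrightarrow> projC S $$ (xCpos S t j k, c) = (if c = xpos S t j k then 1 else 0)"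
    using r by (simp add: projC_def)
  have "(\<exists>t'\<le>horizon S. \<exists>j'\<in>Call S. \<exists>k'<xdim S j'. r = xCpos S t' j' k' \<and> xpos S t j k = xpos S t' j' k')
      \<longleftrightarrow> r = xCpos S t j k" for r
    using t j k inj by metis
  then show "r < NxC S \<Longrightarrow> projC S $$ (r, xpos S t j k) = (if r = xCpos S t j k then 1 else 0)"
    using c by (simp add: projC_def)
qed

lemma index_projC_mult_vec:
  assumes "valid_system S" "t \<le> horizon S" "j \<in> Call S" "k < xdim S j"
  shows "x \<in> carrier_vec (Nx S) \<Longrightarrow> (projC S *\<^sub>v x) $ xCpos S t j k = x $ xpos S t j k"
    and "y \<in> carrier_vec (NxC S) \<Longrightarrow> ((projC S)\<^sup>T *\<^sub>v y) $ xpos S t j k = y $ xCpos S t j k"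
proof -
  have r: "xCpos S t j k < NxC S" by (rule xCpos_less[OF assms])
  have c: "xpos S t j k < Nx S" using assms Call_subset[OF assms(1)] by (intro xpos_less) auto
  have P: "dim_row (projC S) = NxC S" "dim_col (projC S) = Nx S"
    using projC_carrier[of S] by auto
  show "(projC S *\<^sub>v x) $ xCpos S t j k = x $ xpos S t j k" if x: "x \<in> carrier_vec (Nx S)"
  proof -
    have "(projC S *\<^sub>v x) $ xCpos S t j k = (\<Sum>c\<in>{0..<Nx S}. projC S $$ (xCpos S t j k, c) * x $ c)"
      using x r P by (simp add: scalar_prod_def)
    also have "\<dots> = (\<Sum>c\<in>{0..<Nx S}. if c = xpos S t j k then x $ c else 0)"
      by (rule sum.cong) (auto simp: index_projC(1)[OF assms])
    finally show ?thesis using c by simp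
  qed
  show "((projC S)\<^sup>T *\<^sub>v y) $ xpos S t j k = y $ xCpos S t j k" if y: "y \<in> carrier_vec (NxC S)"
  proof -
    have "((projC S)\<^sup>T *\<^sub>v y) $ xpos S t j k = (\<Sum>r\<in>{0..<NxC S}. projC S $$ (r, xpos S t j k) * y $ r)"
      using y c P by (simp add: scalar_prod_def)
    also have "\<dots> = (\<Sum>r\<in>{0..<NxC S}. if r = xCpos S t j k then y $ r else 0)"
      by (rule sum.cong) (auto simp: index_projC(2)[OF assms])
    finally show ?thesis using r by simp
  qed
qed

text \<open>\<open>\<Pi>\<close> selects distinct coordinates, so its rows are orthonormal.\<close>

lemma projC_transpose_right_inverse:
  assumes S: "valid_system S" and y: "y \<in> carrier_vec (NxC S)"
  shows "projC S *\<^sub>v ((projC S)\<^sup>T *\<^sub>v y) = y"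
proof
  have Pt: "(projC S)\<^sup>T *\<^sub>v y \<in> carrier_vec (Nx S)"
    using projC_carrier[of S] y by (auto intro: mult_mat_vec_carrier)
  fix r assume "r < dim_vec y"
  then have "r < NxC S" using y by simp
  then obtain t j k where *: "t \<le> horizon S" "j \<in> Call S" "k < xdim S j" "r = xCpos S t j k"
    by (rule xCpos_cases)
  show "(projC S *\<^sub>v ((projC S)\<^sup>T *\<^sub>v y)) $ r = y $ r"
    unfolding *(4) using index_projC_mult_vec[OF S *(1-3)] Pt y by simp
qed (use y carrier_matD[OF projC_carrier[of S]] in simp)

section \<open>Sparse causal gains\<close>

text \<open>The subspaces \<open>Q\<^sub>N\<close> and \<open>Q\<^sub>C\<close> are the cases \<open>X = Nset S\<close> and \<open>X = Cset S\<close>; entries instead of blocks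
  make products of such matrices easy to handle.\<close>

definition sparse_gain :: "'a dsystem_scheme \<Rightarrow> (nat \<Rightarrow> nat set) \<Rightarrow> real mat set" where
  "sparse_gain S X = {Q \<in> carrier_mat (Nu S) (Nx S).
     \<forall>t<horizon S. \<forall>i<nsub S. \<forall>k<udim S i. \<forall>s\<le>horizon S. \<forall>j<nsub S. \<forall>l<xdim S j.
       Q $$ (upos S t i k, xpos S s j l) \<noteq> 0 \<longrightarrow> s \<le> t \<and> j \<in> X i}"

lemma mblock_eq_0D:
  assumes "mblock d d' N M t s i j = 0\<^sub>m (d i) (d' j)" "k < d i" "l < d' j"
  shows "M $$ (pos d N t i k, pos d' N s j l) = 0"
proof -
  have "mblock d d' N M t s i j $$ (k, l) = 0" using assms by simp
  then show ?thesis using assms(2,3) by (simp add: mblock_def)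
qed

lemma QN_subset_sparse_gain: "QN S \<subseteq> sparse_gain S (Nset S)"
proof
  fix Q assume Q: "Q \<in> QN S"
  have "s \<le> t \<and> j \<in> Nset S i"
    if "t < horizon S" "i < nsub S" "k < udim S i" "s \<le> horizon S" "j < nsub S" "l < xdim S j"
      "Q $$ (upos S t i k, xpos S s j l) \<noteq> 0" for t i k s j l
  proof (rule ccontr)
    assume "\<not> ?thesis"
    then have "mblock (udim S) (xdim S) (nsub S) Q t s i j = 0\<^sub>m (udim S i) (xdim S j)"
      using Q that by (simp add: QN_def)
    then show False using mblock_eq_0D that by blast
  qed
  then show "Q \<in> sparse_gain S (Nset S)" using Q by (simp add: QN_def sparse_gain_def)
qed

lemma QC_subset_sparse_gain: "QC S \<subseteq> sparse_gain S (Cset S)"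
proof
  fix Q assume Q: "Q \<in> QC S"
  have "s \<le> t \<and> j \<in> Cset S i"
    if "t < horizon S" "i < nsub S" "k < udim S i" "s \<le> horizon S" "j < nsub S" "l < xdim S j"
      "Q $$ (upos S t i k, xpos S s j l) \<noteq> 0" for t i k s j l
  proof (rule ccontr)
    assume "\<not> ?thesis"
    then have "mblock (udim S) (xdim S) (nsub S) Q t s i j = 0\<^sub>m (udim S i) (xdim S j)"
      using Q that by (simp add: QC_def)
    then show False using mblock_eq_0D that by blast
  qed
  then show "Q \<in> sparse_gain S (Cset S)" using Q by (simp add: QC_def sparse_gain_def)
qed

lemma Ysub_entry:
  assumes Y: "Y \<in> Ysub S"
    and "t \<le> horizon S" "i < nsub S" "k < xdim S i" "s \<le> horizon S" "j < nsub S" "l < xdim S j"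
    and nz: "Y $$ (xpos S t i k, xpos S s j l) \<noteq> 0"
  shows "s < t \<and> VC_out S i \<subseteq> VC_out S j"
proof (rule ccontr)
  assume "\<not> ?thesis"
  then have "t \<le> s \<or> \<not> VC_out S i \<subseteq> VC_out S j" by auto
  then have "mblock (xdim S) (xdim S) (nsub S) Y t s i j = 0\<^sub>m (xdim S i) (xdim S j)"
    using assms(1-3,5,6) unfolding Ysub_def by blast
  then show False using mblock_eq_0D assms by blast
qed

lemma mult_vec_entries:
  assumes "Q \<in> carrier_mat m (Nx S)" "a \<in> carrier_vec (Nx S)" "r < m"
  shows "(Q *\<^sub>v a) $ r = (\<Sum>e\<in>entries (xdim S) (nsub S) (horizon S + 1).
      Q $$ (r, entry_pos (xdim S) (nsub S) e) * a $ entry_pos (xdim S) (nsub S) e)"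
proof -
  have "(Q *\<^sub>v a) $ r = (\<Sum>c<Nx S. Q $$ (r, c) * a $ c)"
    using assms by (simp add: scalar_prod_def atLeast0LessThan)
  then show ?thesis unfolding Nx_def sum_entries .
qed

lemma sparse_gain_mult_vec:
  assumes Q: "Q \<in> sparse_gain S X" and X: "X i \<subseteq> {..<nsub S}"
    and a: "a \<in> carrier_vec (Nx S)" and t: "t < horizon S" and i: "i < nsub S" and k: "k < udim S i"
  shows "(Q *\<^sub>v a) $ upos S t i k = (\<Sum>(s, j, l)\<in>{(s, j, l). s \<le> t \<and> j \<in> X i \<and> l < xdim S j}.
      Q $$ (upos S t i k, xpos S s j l) * a $ xpos S s j l)"
proof -
  have Qc: "Q \<in> carrier_mat (Nu S) (Nx S)" using Q by (simp add: sparse_gain_def)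
  have "(Q *\<^sub>v a) $ upos S t i k = (\<Sum>(s, j, l)\<in>entries (xdim S) (nsub S) (horizon S + 1).
      Q $$ (upos S t i k, xpos S s j l) * a $ xpos S s j l)"
    using mult_vec_entries[OF Qc a upos_less[OF t i k]] by (simp add: entry_pos_def case_prod_unfold)
  also have "\<dots> = (\<Sum>(s, j, l)\<in>{(s, j, l). s \<le> t \<and> j \<in> X i \<and> l < xdim S j}.
      Q $$ (upos S t i k, xpos S s j l) * a $ xpos S s j l)"
  proof (rule sum.mono_neutral_right)
    show "{(s, j, l). s \<le> t \<and> j \<in> X i \<and> l < xdim S j} \<subseteq> entries (xdim S) (nsub S) (horizon S + 1)"
      using X t by (auto simp: entries_def)
    have "Q $$ (upos S t i k, xpos S s j l) = 0"
      if "s \<le> horizon S" "j < nsub S" "l < xdim S j" "\<not> (s \<le> t \<and> j \<in> X i)" for s j l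
      using Q that t i k unfolding sparse_gain_def by blast
    then show "\<forall>e\<in>entries (xdim S) (nsub S) (horizon S + 1) - {(s, j, l). s \<le> t \<and> j \<in> X i \<and> l < xdim S j}.
        (case e of (s, j, l) \<Rightarrow> Q $$ (upos S t i k, xpos S s j l) * a $ xpos S s j l) = 0"
      unfolding entries_def by (fastforce simp: less_Suc_eq_le)
  qed simp
  finally show ?thesis .
qed

text \<open>A gain supported on \<open>C(i)\<close> reads only components in \<open>C\<close>. This is why the policy can be evaluated
  on \<open>x\<^sub>C\<close>, and why \<open>\<xi>\<close> only has to match the state on \<open>C\<close>.\<close>

lemma sparse_gain_projC_cong:
  assumes S: "valid_system S" and K: "K \<in> sparse_gain S (Cset S)"
    and a: "a \<in> carrier_vec (Nx S)" and b: "b \<in> carrier_vec (Nx S)"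
    and eq: "projC S *\<^sub>v a = projC S *\<^sub>v b"
  shows "K *\<^sub>v a = K *\<^sub>v b"
proof
  have Kc: "K \<in> carrier_mat (Nu S) (Nx S)" using K by (simp add: sparse_gain_def)
  fix r assume "r < dim_vec (K *\<^sub>v b)"
  then have "r < Nu S" using Kc by simp
  then obtain t i k where *: "t < horizon S" "i < nsub S" "k < udim S i" "r = upos S t i k"
    by (rule upos_cases)
  have "a $ xpos S s j l = b $ xpos S s j l" if "s \<le> t" "j \<in> Cset S i" "l < xdim S j" for s j l
  proof -
    have sj: "s \<le> horizon S" "j \<in> Call S" using that * info_subset(3)[OF S *(2)] by auto
    show ?thesis
      using index_projC_mult_vec(1)[OF S sj that(3)] a b eq by metis
  qed
  then show "(K *\<^sub>v a) $ r = (K *\<^sub>v b) $ r"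
    unfolding *(4) sparse_gain_mult_vec[OF K info_subset(2)[OF S *(2)] a *(1-3)]
      sparse_gain_mult_vec[OF K info_subset(2)[OF S *(2)] b *(1-3)]
    by (intro sum.cong) auto
qed (use K in \<open>simp add: sparse_gain_def\<close>)

text \<open>Causality in the form used below: a trajectory vanishes if it vanishes at every time at which its
  whole past does.\<close>

lemma eq_0_by_time:
  fixes v :: "real vec"
  assumes v: "v \<in> carrier_vec (Nx S)"
    and step: "\<And>t i k. t \<le> horizon S \<Longrightarrow> i < nsub S \<Longrightarrow> k < xdim S i \<Longrightarrow>
      (\<And>s j l. s < t \<Longrightarrow> j < nsub S \<Longrightarrow> l < xdim S j \<Longrightarrow> v $ xpos S s j l = 0) \<Longrightarrow>
      v $ xpos S t i k = 0"
  shows "v = 0\<^sub>v (Nx S)"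
proof
  have *: "v $ xpos S t i k = 0" if "t \<le> horizon S" "i < nsub S" "k < xdim S i" for t i k
    using that
  proof (induction t arbitrary: i k rule: less_induct)
    case (less t)
    show ?case
      by (rule step[OF less.prems]) (use less in auto)
  qed
  fix r assume "r < dim_vec (0\<^sub>v (Nx S) :: real vec)"
  then have "r < Nx S" by simp
  then obtain t i k where "t \<le> horizon S" "i < nsub S" "k < xdim S i" "r = xpos S t i k"
    by (rule xpos_cases)
  then show "v $ r = 0\<^sub>v (Nx S) $ r" using * \<open>r < Nx S\<close> by simp
qed (use v in simp)

text \<open>\<open>Y\<close> is strictly causal, so \<open>\<lambda> v = Y v\<close> determines \<open>v(t)\<close> from the strict past of \<open>v\<close>.\<close>

lemma resolvent_injective:
  assumes Y: "Y \<in> Ysub S" and lam: "lam \<noteq> 0"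
    and v: "v \<in> carrier_vec (Nx S)" and Mv: "(lam \<cdot>\<^sub>m 1\<^sub>m (Nx S) - Y) *\<^sub>v v = 0\<^sub>v (Nx S)"
  shows "v = 0\<^sub>v (Nx S)"
proof (rule eq_0_by_time[OF v])
  have Yc: "Y \<in> carrier_mat (Nx S) (Nx S)" using Y by (simp add: Ysub_def)
  fix t i k assume tik: "t \<le> horizon S" "i < nsub S" "k < xdim S i"
    and IH: "\<And>s j l. s < t \<Longrightarrow> j < nsub S \<Longrightarrow> l < xdim S j \<Longrightarrow> v $ xpos S s j l = 0"
  let ?r = "xpos S t i k"
  have r: "?r < Nx S" by (rule xpos_less[OF tik])
  have "(lam \<cdot>\<^sub>m 1\<^sub>m (Nx S) - Y) *\<^sub>v v = lam \<cdot>\<^sub>v v - Y *\<^sub>v v"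
  proof -
    have "(lam \<cdot>\<^sub>m 1\<^sub>m (Nx S) - Y) *\<^sub>v v = (lam \<cdot>\<^sub>m 1\<^sub>m (Nx S)) *\<^sub>v v - Y *\<^sub>v v"
      by (rule minus_mult_distrib_mat_vec) (use Yc v in auto)
    also have "(lam \<cdot>\<^sub>m 1\<^sub>m (Nx S)) *\<^sub>v v = lam \<cdot>\<^sub>v v"
      using v by (intro eq_vecI) auto
    finally show ?thesis .
  qed
  then have "lam \<cdot>\<^sub>v v - Y *\<^sub>v v = 0\<^sub>v (Nx S)" using Mv by simp
  then have "(lam \<cdot>\<^sub>v v - Y *\<^sub>v v) $ ?r = 0" using r by simp
  then have "lam * v $ ?r = (Y *\<^sub>v v) $ ?r" using v Yc r by simp
  also have "\<dots> = 0"
    unfolding mult_vec_entries[OF Yc v r]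
  proof (rule sum.neutral, rule ballI)
    fix e assume "e \<in> entries (xdim S) (nsub S) (horizon S + 1)"
    then obtain s j l where e: "e = (s, j, l)" "s \<le> horizon S" "j < nsub S" "l < xdim S j"
      by (auto simp: entries_def less_Suc_eq_le)
    show "Y $$ (?r, entry_pos (xdim S) (nsub S) e) * v $ entry_pos (xdim S) (nsub S) e = 0"
      using Ysub_entry[OF Y tik e(2-4)] IH[OF _ e(3,4)] by (auto simp: e(1) entry_pos_def)
  qed
  finally show "v $ ?r = 0" using lam by simp
qed

lemma resolvent_inverse:
  assumes Y: "Y \<in> Ysub S" and lam: "lam \<noteq> 0"
  defines "M \<equiv> lam \<cdot>\<^sub>m 1\<^sub>m (Nx S) - Y"
  shows "M \<in> carrier_mat (Nx S) (Nx S)" "minv M \<in> carrier_mat (Nx S) (Nx S)"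
    "M * minv M = 1\<^sub>m (Nx S)" "minv M * M = 1\<^sub>m (Nx S)"
proof -
  show M: "M \<in> carrier_mat (Nx S) (Nx S)"
    using Y by (auto simp: Ysub_def M_def)
  show "minv M \<in> carrier_mat (Nx S) (Nx S)" "M * minv M = 1\<^sub>m (Nx S)" "minv M * M = 1\<^sub>m (Nx S)"
    using minv_inverse[OF M] resolvent_injective[OF Y lam] unfolding M_def by blast+
qed

text \<open>From \<open>\<lambda> Z = I + Y Z\<close>, a nonzero entry of the inverse \<open>Z\<close> off the diagonal comes from a nonzero entry
  of \<open>Y\<close> leading to a strictly earlier row of \<open>Z\<close>; induction on time and transitivity of \<open>\<subseteq>\<close> conclude.\<close>

lemma resolvent_entry:
  assumes Y: "Y \<in> Ysub S" and lam: "lam \<noteq> 0"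
    and tik: "t \<le> horizon S" "i < nsub S" "k < xdim S i"
    and sjl: "s \<le> horizon S" "j < nsub S" "l < xdim S j"
    and nz: "minv (lam \<cdot>\<^sub>m 1\<^sub>m (Nx S) - Y) $$ (xpos S t i k, xpos S s j l) \<noteq> 0"
  shows "s \<le> t \<and> VC_out S i \<subseteq> VC_out S j"
  using tik nz
proof (induction t arbitrary: i k rule: less_induct)
  case (less t)
  define M where "M = lam \<cdot>\<^sub>m 1\<^sub>m (Nx S) - Y"
  define Z where "Z = minv M"
  note inv = resolvent_inverse[OF Y lam, folded M_def, folded Z_def]
  have Yc: "Y \<in> carrier_mat (Nx S) (Nx S)" using Y by (simp add: Ysub_def)
  let ?r = "xpos S t i k" and ?c = "xpos S s j l"
  have r: "?r < Nx S" "?c < Nx S" using less.prems sjl by (auto intro: xpos_less)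
  show ?case
  proof (cases "?r = ?c")
    case True
    then show ?thesis using pos_inj[of i "nsub S" k "xdim S" j l t s] less.prems sjl by auto
  next
    case False
    have z: "col Z ?c \<in> carrier_vec (Nx S)" using inv r by auto
    have "(M * Z) $$ (?r, ?c) = 0" using inv(3) r False by simp
    moreover have "(M * Z) $$ (?r, ?c) = lam * Z $$ (?r, ?c) - (Y *\<^sub>v col Z ?c) $ ?r"
    proof -
      have "M * Z = lam \<cdot>\<^sub>m Z - Y * Z"
        unfolding M_def using minus_mult_distrib_mat[of "lam \<cdot>\<^sub>m 1\<^sub>m (Nx S)" "Nx S" "Nx S" Y Z "Nx S"]
          mult_smult_assoc_mat[of "1\<^sub>m (Nx S)" "Nx S" "Nx S" Z "Nx S" lam] Yc inv(2) by simp
      then show ?thesis using Yc inv(2) r by simp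
    qed
    moreover have "Z $$ (?r, ?c) \<noteq> 0" using less.prems(4) by (simp add: Z_def M_def)
    ultimately have "(Y *\<^sub>v col Z ?c) $ ?r \<noteq> 0" using lam by auto
    then obtain e where e: "e \<in> entries (xdim S) (nsub S) (horizon S + 1)"
      "Y $$ (?r, entry_pos (xdim S) (nsub S) e) * col Z ?c $ entry_pos (xdim S) (nsub S) e \<noteq> 0"
      unfolding mult_vec_entries[OF Yc z r(1)] by (meson sum.not_neutral_contains_not_neutral)
    then obtain s' j' l' where e': "e = (s', j', l')" "s' \<le> horizon S" "j' < nsub S" "l' < xdim S j'"
      by (auto simp: entries_def less_Suc_eq_le)
    have "Y $$ (?r, xpos S s' j' l') \<noteq> 0" "Z $$ (xpos S s' j' l', ?c) \<noteq> 0"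
      using e(2) xpos_less[OF e'(2-4)] inv(2) r by (auto simp: e'(1) entry_pos_def)
    then have "s' < t \<and> VC_out S i \<subseteq> VC_out S j'" "s' < t \<longrightarrow> s \<le> s' \<and> VC_out S j' \<subseteq> VC_out S j"
      using Ysub_entry[OF Y less.prems(1-3) e'(2-4)] less.IH[OF _ e'(2-4)]
      by (auto simp: Z_def M_def)
    then show ?thesis by auto
  qed
qed

lemma mem_VC_out_iff: "i \<in> VC_out S j \<longleftrightarrow> j \<in> Cset S i"
  by (auto simp: VC_out_def coupling_edges_def Cset_def VI_in_def)

text \<open>If \<open>j' \<in> C(i)\<close>, then \<open>i\<close> is an out-neighbour of \<open>j'\<close> in the coupling graph. A nonzero entry of
  the inverse in row \<open>j'\<close> and column \<open>j\<close> means that all out-neighbours of \<open>j'\<close> are out-neighbours of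
  \<open>j\<close>, so \<open>j \<in> C(i)\<close>.\<close>

lemma sparse_gain_resolvent:
  assumes S: "valid_system S" and Q: "Q \<in> sparse_gain S (Cset S)" and Y: "Y \<in> Ysub S" and lam: "lam \<noteq> 0"
  shows "Q * minv (lam \<cdot>\<^sub>m 1\<^sub>m (Nx S) - Y) \<in> sparse_gain S (Cset S)"
proof -
  define Z where "Z = minv (lam \<cdot>\<^sub>m 1\<^sub>m (Nx S) - Y)"
  have Zc: "Z \<in> carrier_mat (Nx S) (Nx S)" using resolvent_inverse[OF Y lam] by (simp add: Z_def)
  have Qc: "Q \<in> carrier_mat (Nu S) (Nx S)" using Q by (simp add: sparse_gain_def)
  have "s \<le> t \<and> j \<in> Cset S i"
    if tik: "t < horizon S" "i < nsub S" "k < udim S i"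
      and sjl: "s \<le> horizon S" "j < nsub S" "l < xdim S j"
      and nz: "(Q * Z) $$ (upos S t i k, xpos S s j l) \<noteq> 0" for t i k s j l
  proof -
    have r: "upos S t i k < Nu S" "xpos S s j l < Nx S"
      using upos_less[OF tik] xpos_less[OF sjl] by auto
    have z: "col Z (xpos S s j l) \<in> carrier_vec (Nx S)" using Zc r by auto
    have "(Q *\<^sub>v col Z (xpos S s j l)) $ upos S t i k \<noteq> 0" using nz r Qc Zc by simp
    then obtain e where e: "e \<in> {(s, j, l). s \<le> t \<and> j \<in> Cset S i \<and> l < xdim S j}"
      "(case e of (s', j', l') \<Rightarrow>
        Q $$ (upos S t i k, xpos S s' j' l') * col Z (xpos S s j l) $ xpos S s' j' l') \<noteq> 0"
      unfolding sparse_gain_mult_vec[OF Q info_subset(2)[OF S tik(2)] z tik]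
      by (meson sum.not_neutral_contains_not_neutral)
    then obtain s' j' l' where e': "e = (s', j', l')" "s' \<le> t" "j' \<in> Cset S i" "l' < xdim S j'"
      by auto
    have s': "s' \<le> horizon S" "j' < nsub S" using e' tik info_subset(2)[OF S tik(2)] by auto
    have "Z $$ (xpos S s' j' l', xpos S s j l) \<noteq> 0"
      using e(2) xpos_less[OF s' e'(4)] Zc r by (auto simp: e'(1))
    then have "s \<le> s' \<and> VC_out S j' \<subseteq> VC_out S j"
      using resolvent_entry[OF Y lam s' e'(4) sjl] by (simp add: Z_def)
    moreover have "i \<in> VC_out S j'" using e' by (simp add: mem_VC_out_iff)
    ultimately have "i \<in> VC_out S j" "s \<le> t" using e' by auto
    then show ?thesis by (simp add: mem_VC_out_iff)
  qed
  then show ?thesis using Qc Zc unfolding sparse_gain_def Z_def by auto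
qed

lemma projC_mult_transpose_injective:
  assumes S: "valid_system S"
    and M: "M \<in> carrier_mat (Nx S) (Nx S)" "minv M \<in> carrier_mat (Nx S) (Nx S)"
      "M * minv M = 1\<^sub>m (Nx S)"
    and y: "y \<in> carrier_vec (NxC S)" and eq: "(projC S * M)\<^sup>T *\<^sub>v y = 0\<^sub>v (Nx S)"
  shows "y = 0\<^sub>v (NxC S)"
proof -
  have CT: "(projC S)\<^sup>T \<in> carrier_mat (Nx S) (NxC S)" using projC_carrier[of S] by simp
  have MT: "M\<^sup>T \<in> carrier_mat (Nx S) (Nx S)" "(minv M)\<^sup>T \<in> carrier_mat (Nx S) (Nx S)" using M by auto
  have CTy: "(projC S)\<^sup>T *\<^sub>v y \<in> carrier_vec (Nx S)" by (rule mult_mat_vec_carrier[OF CT y])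
  have "M\<^sup>T *\<^sub>v ((projC S)\<^sup>T *\<^sub>v y) = 0\<^sub>v (Nx S)"
    using eq transpose_mult[OF projC_carrier M(1)] assoc_mult_mat_vec[OF MT(1) CT y] by simp
  moreover have "(minv M)\<^sup>T * M\<^sup>T = 1\<^sub>m (Nx S)" using transpose_mult[OF M(1,2)] M(3) by simp
  ultimately have "(projC S)\<^sup>T *\<^sub>v y = (minv M)\<^sup>T *\<^sub>v 0\<^sub>v (Nx S)"
    using assoc_mult_mat_vec[OF MT(2,1) CTy] CTy by simp
  then have "(projC S)\<^sup>T *\<^sub>v y = 0\<^sub>v (Nx S)" using MT(2) by (auto intro!: eq_vecI simp: scalar_prod_def)
  then have "projC S *\<^sub>v ((projC S)\<^sup>T *\<^sub>v y) = 0\<^sub>v (NxC S)"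
    using projC_carrier[of S] by (auto intro!: eq_vecI simp: scalar_prod_def)
  then show ?thesis using projC_transpose_right_inverse[OF S y] by simp
qed

section \<open>Closed loop and policies\<close>

text \<open>The surrogate recursion reads \<open>v\<close> instead of \<open>x\<close> on \<open>C(i)\<close>; for \<open>v = x\<close> nothing changes.\<close>

lemma dynamics_iff_surrogate:
  assumes S: "valid_system S"
  shows "dynamics S x u w \<longleftrightarrow> surrogate_dynamics S x u w x"
proof -
  have split: "(\<Sum>j<nsub S. f j + g j) = (\<Sum>j\<in>{..<nsub S} - Cset S i. f j) + (\<Sum>j\<in>Cset S i. f j) + (\<Sum>j<nsub S. g j)"
    if "i < nsub S" for f g :: "nat \<Rightarrow> real" and i
    using sum.subset_diff[OF info_subset(2)[OF S that], of f] by (simp add: sum.distrib)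
  show ?thesis
    unfolding dynamics_def surrogate_dynamics_def using split by simp
qed

lemma dynamics_iff_matrices:
  assumes "valid_system S" "surrogate_matrices S Bt Lt Ht"
    and "x \<in> carrier_vec (Nx S)" "u \<in> carrier_vec (Nu S)" "w \<in> carrier_vec (Nx S)"
  shows "dynamics S x u w \<longleftrightarrow> x = Bt *\<^sub>v u + Lt *\<^sub>v w + Ht *\<^sub>v (projC S *\<^sub>v x)"
  using assms by (simp add: dynamics_iff_surrogate surrogate_matrices_def)

text \<open>With zero disturbance the initial state vanishes, and a zero past of the state produces zero inputs
  and hence a zero next state.\<close>

lemma homogeneous_closed_loop:
  assumes S: "valid_system S" and K: "K \<in> sparse_gain S (Cset S)" and x: "x \<in> carrier_vec (Nx S)"
    and dyn: "dynamics S x (K *\<^sub>v x) (0\<^sub>v (Nx S))"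
  shows "x = 0\<^sub>v (Nx S)"
proof (rule eq_0_by_time[OF x])
  have xb: "xblock S t i v $ k = v $ xpos S t i k" if "k < xdim S i" for t i k v
    using that by (simp add: vblock_def)
  fix t i k assume tik: "t \<le> horizon S" "i < nsub S" "k < xdim S i"
    and IH: "\<And>s j l. s < t \<Longrightarrow> j < nsub S \<Longrightarrow> l < xdim S j \<Longrightarrow> x $ xpos S s j l = 0"
  have r: "xpos S t i k < Nx S" by (rule xpos_less[OF tik])
  show "x $ xpos S t i k = 0"
  proof (cases t)
    case 0
    have "xblock S 0 i x = xblock S 0 i (0\<^sub>v (Nx S))" using dyn tik by (simp add: dynamics_def)
    from arg_cong[OF this, of "\<lambda>v. v $ k"] show ?thesis using xb[OF tik(3), of 0] r 0 by simp
  next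
    case (Suc t')
    have t': "t' < horizon S" using Suc tik by simp
    have x0: "xblock S t' j x = 0\<^sub>v (xdim S j)" if "j < nsub S" for j
      using IH[of t' j] Suc that by (intro eq_vecI) (auto simp: vblock_def)
    have u0: "ublock S t' j (K *\<^sub>v x) = 0\<^sub>v (udim S j)" if j: "j < nsub S" for j
    proof (rule eq_vecI)
      fix l assume "l < dim_vec (0\<^sub>v (udim S j) :: real vec)"
      then have l: "l < udim S j" by simp
      have "(K *\<^sub>v x) $ upos S t' j l = 0"
        unfolding sparse_gain_mult_vec[OF K info_subset(2)[OF S j] x t' j l]
        using info_subset(2)[OF S j] Suc by (intro sum.neutral) (auto intro!: IH)
      then show "ublock S t' j (K *\<^sub>v x) $ l = 0\<^sub>v (udim S j) $ l" using l by (simp add: vblock_def)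
    qed (simp add: vblock_def)
    have ab: "(amat S t' i j *\<^sub>v 0\<^sub>v (xdim S j)) $ k = 0" "(bmat S t' i j *\<^sub>v 0\<^sub>v (udim S j)) $ k = 0"
      if "j < nsub S" for j
    proof -
      have "amat S t' i j \<in> carrier_mat (xdim S i) (xdim S j)" "bmat S t' i j \<in> carrier_mat (xdim S i) (udim S j)"
        using S t' tik that by (auto simp: valid_system_def)
      then show "(amat S t' i j *\<^sub>v 0\<^sub>v (xdim S j)) $ k = 0" "(bmat S t' i j *\<^sub>v 0\<^sub>v (udim S j)) $ k = 0"
        using tik by (auto simp: scalar_prod_def)
    qed
    have "xblock S (t' + 1) i x $ k = (\<Sum>j<nsub S. (amat S t' i j *\<^sub>v xblock S t' j x) $ k
        + (bmat S t' i j *\<^sub>v ublock S t' j (K *\<^sub>v x)) $ k) + xblock S (t' + 1) i (0\<^sub>v (Nx S)) $ k"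
      using dyn t' tik unfolding dynamics_def by blast
    also have "\<dots> = xblock S (t' + 1) i (0\<^sub>v (Nx S)) $ k" by (simp add: x0 u0 ab)
    finally show ?thesis using xb[OF tik(3)] r Suc by simp
  qed
qed

text \<open>Well-posedness. In terms of the surrogate matrices this is a square linear system for \<open>x\<close>, so
  existence follows from uniqueness in the homogeneous case.\<close>

lemma closed_loop_equation:
  assumes S: "valid_system S" and SM: "surrogate_matrices S Bt Lt Ht" and K: "K \<in> sparse_gain S (Cset S)"
    and c: "c \<in> carrier_vec (Nu S)" and w: "w \<in> carrier_vec (Nx S)"
  shows "\<exists>!x. x \<in> carrier_vec (Nx S) \<and> dynamics S x (c + K *\<^sub>v x) w"
proof -
  have B: "Bt \<in> carrier_mat (Nx S) (Nu S)" and L: "Lt \<in> carrier_mat (Nx S) (Nx S)"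
    and H: "Ht \<in> carrier_mat (Nx S) (NxC S)" using SM by (auto simp: surrogate_matrices_def)
  have Kc: "K \<in> carrier_mat (Nu S) (Nx S)" using K by (simp add: sparse_gain_def)
  note Pc = projC_carrier[of S]
  define E where "E = Bt * K + Ht * projC S"
  define A where "A = 1\<^sub>m (Nx S) - E"
  define b where "b = Bt *\<^sub>v c + Lt *\<^sub>v w"
  have E: "E \<in> carrier_mat (Nx S) (Nx S)" unfolding E_def using B Kc H Pc by auto
  have A: "A \<in> carrier_mat (Nx S) (Nx S)" unfolding A_def using E by (auto intro: minus_carrier_mat)
  have b: "b \<in> carrier_vec (Nx S)" unfolding b_def using B L c w by auto
  have Ex: "E *\<^sub>v x = Bt *\<^sub>v (K *\<^sub>v x) + Ht *\<^sub>v (projC S *\<^sub>v x)" if x: "x \<in> carrier_vec (Nx S)" for x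
  proof -
    have "E *\<^sub>v x = Bt * K *\<^sub>v x + Ht * projC S *\<^sub>v x"
      unfolding E_def by (rule add_mult_distrib_mat_vec) (use B Kc H Pc x in auto)
    then show ?thesis using assoc_mult_mat_vec[OF B Kc x] assoc_mult_mat_vec[OF H Pc x] by simp
  qed
  have Ax: "A *\<^sub>v x = x - E *\<^sub>v x" if x: "x \<in> carrier_vec (Nx S)" for x
    unfolding A_def using minus_mult_distrib_mat_vec[OF one_carrier_mat E x] x by simp
  have dyn_iff: "dynamics S x (c' + K *\<^sub>v x) w' \<longleftrightarrow> A *\<^sub>v x = Bt *\<^sub>v c' + Lt *\<^sub>v w'"
    if x: "x \<in> carrier_vec (Nx S)" and c': "c' \<in> carrier_vec (Nu S)" and w': "w' \<in> carrier_vec (Nx S)"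
    for x c' w'
  proof -
    have Kx: "K *\<^sub>v x \<in> carrier_vec (Nu S)" using Kc x by simp
    have "Bt *\<^sub>v (c' + K *\<^sub>v x) = Bt *\<^sub>v c' + Bt *\<^sub>v (K *\<^sub>v x)"
      by (rule mult_add_distrib_mat_vec[OF B c' Kx])
    then have "dynamics S x (c' + K *\<^sub>v x) w' \<longleftrightarrow>
        x = Bt *\<^sub>v c' + Bt *\<^sub>v (K *\<^sub>v x) + Lt *\<^sub>v w' + Ht *\<^sub>v (projC S *\<^sub>v x)"
      using dynamics_iff_matrices[OF S SM x _ w', of "c' + K *\<^sub>v x"] c' Kx by simp
    also have "\<dots> \<longleftrightarrow> x = (Bt *\<^sub>v c' + Lt *\<^sub>v w') + E *\<^sub>v x"
    proof -
      have "Bt *\<^sub>v c' + Bt *\<^sub>v (K *\<^sub>v x) + Lt *\<^sub>v w' + Ht *\<^sub>v (projC S *\<^sub>v x)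
          = (Bt *\<^sub>v c' + Lt *\<^sub>v w') + E *\<^sub>v x"
        unfolding Ex[OF x] using B L H by (intro eq_vecI) auto
      then show ?thesis by simp
    qed
    also have "\<dots> \<longleftrightarrow> A *\<^sub>v x = Bt *\<^sub>v c' + Lt *\<^sub>v w'"
    proof -
      have iff: "x = y + z \<longleftrightarrow> x - z = y"
        if "y \<in> carrier_vec (Nx S)" "z \<in> carrier_vec (Nx S)" for y z :: "real vec"
        using x that by (auto simp: vec_eq_iff)
      show ?thesis unfolding Ax[OF x] by (rule iff) (use B L c' w' E x in auto)
    qed
    finally show ?thesis .
  qed
  have inj: "x = 0\<^sub>v (Nx S)" if x: "x \<in> carrier_vec (Nx S)" and "A *\<^sub>v x = 0\<^sub>v (Nx S)" for x
  proof -
    have "Bt *\<^sub>v 0\<^sub>v (Nu S) + Lt *\<^sub>v 0\<^sub>v (Nx S) = 0\<^sub>v (Nx S)" using B L by (intro eq_vecI) (auto simp: scalar_prod_def)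
    then have "dynamics S x (0\<^sub>v (Nu S) + K *\<^sub>v x) (0\<^sub>v (Nx S))" using dyn_iff[OF x] that by simp
    then show ?thesis using homogeneous_closed_loop[OF S K x] Kc x by simp
  qed
  note inv = minv_inverse[OF A inj]
  show ?thesis
  proof (rule ex1I[of _ "minv A *\<^sub>v b"])
    have "minv A *\<^sub>v b \<in> carrier_vec (Nx S)" using inv(1) b by simp
    moreover have "A *\<^sub>v (minv A *\<^sub>v b) = b" using assoc_mult_mat_vec[OF A inv(1) b] inv(2) b by simp
    ultimately show "minv A *\<^sub>v b \<in> carrier_vec (Nx S) \<and> dynamics S (minv A *\<^sub>v b) (c + K *\<^sub>v (minv A *\<^sub>v b)) w"
      using dyn_iff[OF _ c w] by (simp add: b_def)
  next
    fix x assume "x \<in> carrier_vec (Nx S) \<and> dynamics S x (c + K *\<^sub>v x) w"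
    then have x: "x \<in> carrier_vec (Nx S)" "A *\<^sub>v x = b" using dyn_iff[OF _ c w] by (auto simp: b_def)
    then show "x = minv A *\<^sub>v b" using assoc_mult_mat_vec[OF inv(1) A x(1)] inv(3) by simp
  qed
qed

text \<open>By sparsity, component \<open>i\<close> of the input at time \<open>t\<close> is a constant plus a finite linear combination
  of the data available there, hence a measurable function of them. The transposed projection embeds
  \<open>x\<^sub>C\<close> into state trajectories.\<close>

lemma affine_policy:
  assumes S: "valid_system S" and c: "c \<in> carrier_vec (Nu S)"
    and Q: "Q \<in> sparse_gain S (Nset S)" and K: "K \<in> sparse_gain S (Cset S)"
  shows "(\<lambda>w y. c + Q *\<^sub>v w + K *\<^sub>v ((projC S)\<^sup>T *\<^sub>v y)) \<in> policies S"
proof -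
  have Qc: "Q \<in> carrier_mat (Nu S) (Nx S)" and Kc: "K \<in> carrier_mat (Nu S) (Nx S)"
    using Q K by (auto simp: sparse_gain_def)
  have PT: "(projC S)\<^sup>T \<in> carrier_mat (Nx S) (NxC S)" using projC_carrier[of S] by simp
  let ?\<phi> = "\<lambda>w y. c + Q *\<^sub>v w + K *\<^sub>v ((projC S)\<^sup>T *\<^sub>v y)"
  have "\<exists>\<psi> \<in> Pi\<^sub>M (y_index S i t) (\<lambda>_. borel) \<Otimes>\<^sub>M Pi\<^sub>M (w_index S i t) (\<lambda>_. borel) \<rightarrow>\<^sub>M vec_borel (udim S i).
          \<forall>w\<in>carrier_vec (Nx S). \<forall>y\<in>carrier_vec (NxC S).
            ublock S t i (?\<phi> w y) = \<psi> (y_data S i t y, w_data S i t w)"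
    if i: "i < nsub S" and t: "t < horizon S" for i t
  proof -
    define \<psi> where "\<psi> = (\<lambda>(yd, wd). vec (udim S i) (\<lambda>k. c $ upos S t i k
        + (\<Sum>e\<in>w_index S i t. Q $$ (upos S t i k, entry_pos (xdim S) (nsub S) e) * wd e)
        + (\<Sum>e\<in>y_index S i t. K $$ (upos S t i k, entry_pos (xdim S) (nsub S) e) * yd e)))"
    have "\<psi> \<in> Pi\<^sub>M (y_index S i t) (\<lambda>_. borel) \<Otimes>\<^sub>M Pi\<^sub>M (w_index S i t) (\<lambda>_. borel) \<rightarrow>\<^sub>M vec_borel (udim S i)"
      unfolding vec_borel_def
    proof (rule measurable_vimage_algebra2)
      let ?M = "Pi\<^sub>M (y_index S i t) (\<lambda>_. borel :: real measure) \<Otimes>\<^sub>M Pi\<^sub>M (w_index S i t) (\<lambda>_. borel :: real measure)"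
      show "\<psi> \<in> space ?M \<rightarrow> carrier_vec (udim S i)" by (auto simp: \<psi>_def)
      have [measurable]: "(\<lambda>z. fst z e) \<in> borel_measurable ?M" if "e \<in> y_index S i t" for e
        using measurable_compose[OF measurable_fst measurable_component_singleton[OF that]] .
      have [measurable]: "(\<lambda>z. snd z e) \<in> borel_measurable ?M" if "e \<in> w_index S i t" for e
        using measurable_compose[OF measurable_snd measurable_component_singleton[OF that]] .
      show "(\<lambda>z. \<lambda>k\<in>{..<udim S i}. \<psi> z $ k) \<in> ?M \<rightarrow>\<^sub>M Pi\<^sub>M {..<udim S i} (\<lambda>_. borel)"
      proof (rule measurable_restrict)
        fix k assume "k \<in> {..<udim S i}"
        then have "(\<lambda>z. \<psi> z $ k) = (\<lambda>z. c $ upos S t i k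
          + (\<Sum>e\<in>w_index S i t. Q $$ (upos S t i k, entry_pos (xdim S) (nsub S) e) * snd z e)
          + (\<Sum>e\<in>y_index S i t. K $$ (upos S t i k, entry_pos (xdim S) (nsub S) e) * fst z e))"
          by (auto simp: \<psi>_def)
        then show "(\<lambda>z. \<psi> z $ k) \<in> borel_measurable ?M" by simp
      qed
    qed
    moreover have "ublock S t i (?\<phi> w y) = \<psi> (y_data S i t y, w_data S i t w)"
      if w: "w \<in> carrier_vec (Nx S)" and y: "y \<in> carrier_vec (NxC S)" for w y
    proof (rule eq_vecI)
      fix k assume "k < dim_vec (\<psi> (y_data S i t y, w_data S i t w))"
      then have k: "k < udim S i" by (simp add: \<psi>_def)
      have y': "(projC S)\<^sup>T *\<^sub>v y \<in> carrier_vec (Nx S)" by (rule mult_mat_vec_carrier[OF PT y])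
      have "(Q *\<^sub>v w) $ upos S t i k = (\<Sum>e\<in>w_index S i t.
          Q $$ (upos S t i k, entry_pos (xdim S) (nsub S) e) * w_data S i t w e)"
        unfolding sparse_gain_mult_vec[OF Q info_subset(1)[OF S i] w t i k] w_index_def[symmetric]
        by (rule sum.cong) (auto simp: w_data_def w_index_def entry_pos_def vblock_def)
      moreover have "(K *\<^sub>v ((projC S)\<^sup>T *\<^sub>v y)) $ upos S t i k = (\<Sum>e\<in>y_index S i t.
          K $$ (upos S t i k, entry_pos (xdim S) (nsub S) e) * y_data S i t y e)"
        unfolding sparse_gain_mult_vec[OF K info_subset(2)[OF S i] y' t i k] y_index_def[symmetric]
      proof (rule sum.cong)
        fix e assume e: "e \<in> y_index S i t"
        then obtain s j l where e': "e = (s, j, l)" "s \<le> t" "j \<in> Cset S i" "l < xdim S j"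
          by (auto simp: y_index_def)
        have sj: "s \<le> horizon S" "j \<in> Call S" using e' t info_subset(3)[OF S i] by auto
        have "((projC S)\<^sup>T *\<^sub>v y) $ xpos S s j l = xCblock S s j y $ l"
          using index_projC_mult_vec(2)[OF S sj e'(4) y] e'(4) sj by (simp add: vblock_def xCdim_def)
        then show "(case e of (s, j, l) \<Rightarrow> K $$ (upos S t i k, xpos S s j l) * ((projC S)\<^sup>T *\<^sub>v y) $ xpos S s j l)
            = K $$ (upos S t i k, entry_pos (xdim S) (nsub S) e) * y_data S i t y e"
          using e by (simp add: e'(1) y_data_def entry_pos_def)
      qed simp
      ultimately show "ublock S t i (?\<phi> w y) $ k = \<psi> (y_data S i t y, w_data S i t w) $ k"
        using k upos_less[OF t i k] c Qc Kc by (simp add: \<psi>_def vblock_def)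
    qed (simp add: \<psi>_def vblock_def)
    ultimately show ?thesis by blast
  qed
  moreover have "\<forall>w\<in>carrier_vec (Nx S). \<forall>y\<in>carrier_vec (NxC S). ?\<phi> w y \<in> carrier_vec (Nu S)"
    using c Qc Kc mult_mat_vec_carrier[OF PT] by auto
  ultimately show ?thesis unfolding policies_def by blast
qed

section \<open>The matrix inequality\<close>

lemma block33_form:
  assumes psd: "psd_mat (a + n + m) (block33 A B C B\<^sup>T D (0\<^sub>m n m) C\<^sup>T (0\<^sub>m m n) F)"
    and A: "A \<in> carrier_mat a a" and B: "B \<in> carrier_mat a n" and C: "C \<in> carrier_mat a m"
    and D: "D \<in> carrier_mat n n" and F: "F \<in> carrier_mat m m"
    and y: "y \<in> carrier_vec a" and p: "p \<in> carrier_vec n" and q: "q \<in> carrier_vec m"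
  shows "0 \<le> y \<bullet> (A *\<^sub>v y) + 2 * (y \<bullet> (B *\<^sub>v p)) + 2 * (y \<bullet> (C *\<^sub>v q)) + p \<bullet> (D *\<^sub>v p) + q \<bullet> (F *\<^sub>v q)"
proof -
  let ?M = "block33 A B C B\<^sup>T D (0\<^sub>m n m) C\<^sup>T (0\<^sub>m m n) F"
  have BT: "B\<^sup>T \<in> carrier_mat n a" and CT: "C\<^sup>T \<in> carrier_mat m a" using B C by auto
  have pq: "p @\<^sub>v q \<in> carrier_vec (n + m)" using p q by simp
  have cols: "append_cols B C \<in> carrier_mat a (n + m)"
    using B C by (auto simp: append_cols_def)
  have colsv: "append_cols B C *\<^sub>v (p @\<^sub>v q) = B *\<^sub>v p + C *\<^sub>v q"
  proof -
    have "append_cols B C *\<^sub>v (p @\<^sub>v q) = (B *\<^sub>v p + C *\<^sub>v q) @\<^sub>v (0\<^sub>m 0 n *\<^sub>v p + 0\<^sub>m 0 m *\<^sub>v q)"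
      unfolding append_cols_def carrier_matD[OF B] carrier_matD[OF C]
      by (rule four_block_mat_mult_vec[OF B C _ _ p q]) auto
    also have "\<dots> = B *\<^sub>v p + C *\<^sub>v q" by (rule eq_vecI) auto
    finally show ?thesis .
  qed
  have diag: "four_block_mat D (0\<^sub>m n m) (0\<^sub>m m n) F *\<^sub>v (p @\<^sub>v q) = D *\<^sub>v p @\<^sub>v F *\<^sub>v q"
    by (rule mult_mat_vec_split[OF D F p q])
  have dc: "four_block_mat D (0\<^sub>m n m) (0\<^sub>m m n) F \<in> carrier_mat (n + m) (n + m)"
    using D F by auto
  have rows: "(B\<^sup>T @\<^sub>r C\<^sup>T) *\<^sub>v y = B\<^sup>T *\<^sub>v y @\<^sub>v C\<^sup>T *\<^sub>v y"
    by (rule mat_mult_append[OF BT CT y])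
  have Mv: "?M *\<^sub>v (y @\<^sub>v (p @\<^sub>v q))
      = (A *\<^sub>v y + (B *\<^sub>v p + C *\<^sub>v q)) @\<^sub>v ((B\<^sup>T *\<^sub>v y @\<^sub>v C\<^sup>T *\<^sub>v y) + (D *\<^sub>v p @\<^sub>v F *\<^sub>v q))"
    unfolding block33_def
    using four_block_mat_mult_vec[OF A cols carrier_append_rows[OF BT CT] dc y pq]
    by (simp add: colsv diag rows)
  have "y @\<^sub>v (p @\<^sub>v q) \<in> carrier_vec (a + n + m)" using y pq by (simp add: add.assoc)
  then have "0 \<le> (y @\<^sub>v (p @\<^sub>v q)) \<bullet> (?M *\<^sub>v (y @\<^sub>v (p @\<^sub>v q)))"
    using psd unfolding psd_mat_def by blast
  also have "\<dots> = y \<bullet> (A *\<^sub>v y + (B *\<^sub>v p + C *\<^sub>v q))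
      + (p @\<^sub>v q) \<bullet> ((B\<^sup>T *\<^sub>v y @\<^sub>v C\<^sup>T *\<^sub>v y) + (D *\<^sub>v p @\<^sub>v F *\<^sub>v q))"
    unfolding Mv by (rule scalar_prod_append[OF y pq]) (use A B C D F BT CT y p q in auto)
  also have "(p @\<^sub>v q) \<bullet> ((B\<^sup>T *\<^sub>v y @\<^sub>v C\<^sup>T *\<^sub>v y) + (D *\<^sub>v p @\<^sub>v F *\<^sub>v q))
      = (p @\<^sub>v q) \<bullet> ((B\<^sup>T *\<^sub>v y + D *\<^sub>v p) @\<^sub>v (C\<^sup>T *\<^sub>v y + F *\<^sub>v q))"
  proof -
    have "(B\<^sup>T *\<^sub>v y @\<^sub>v C\<^sup>T *\<^sub>v y) + (D *\<^sub>v p @\<^sub>v F *\<^sub>v q) = (B\<^sup>T *\<^sub>v y + D *\<^sub>v p) @\<^sub>v (C\<^sup>T *\<^sub>v y + F *\<^sub>v q)"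
      by (rule append_vec_add[of _ n _ _ m]) (use BT CT D F y p q in auto)
    then show ?thesis by simp
  qed
  also have "\<dots> = p \<bullet> (B\<^sup>T *\<^sub>v y + D *\<^sub>v p) + q \<bullet> (C\<^sup>T *\<^sub>v y + F *\<^sub>v q)"
    by (rule scalar_prod_append[OF p q]) (use BT CT D F y p q in auto)
  also have "y \<bullet> (A *\<^sub>v y + (B *\<^sub>v p + C *\<^sub>v q)) = y \<bullet> (A *\<^sub>v y) + (y \<bullet> (B *\<^sub>v p) + y \<bullet> (C *\<^sub>v q))"
    using y p q A B C by (simp add: scalar_prod_add_distrib[of _ a])
  also have "p \<bullet> (B\<^sup>T *\<^sub>v y + D *\<^sub>v p) = y \<bullet> (B *\<^sub>v p) + p \<bullet> (D *\<^sub>v p)"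
    using y p BT D transpose_vec_mult_scalar[OF B p y] comm_scalar_prod[OF p, of "B\<^sup>T *\<^sub>v y"]
    by (simp add: scalar_prod_add_distrib[of _ n])
  also have "q \<bullet> (C\<^sup>T *\<^sub>v y + F *\<^sub>v q) = y \<bullet> (C *\<^sub>v q) + q \<bullet> (F *\<^sub>v q)"
    using y q CT F transpose_vec_mult_scalar[OF C q y] comm_scalar_prod[OF q, of "C\<^sup>T *\<^sub>v y"]
    by (simp add: scalar_prod_add_distrib[of _ m])
  finally show ?thesis by simp
qed

text \<open>The minimiser of \<open>\<xi> \<bullet> \<Sigma>\<^sup>-\<^sup>1 \<xi>\<close> subject to \<open>K \<xi> = z\<close> is \<open>\<xi> = \<Sigma> K\<^sup>T y\<close> with multiplier \<open>y\<close> determined by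
  \<open>K \<Sigma> K\<^sup>T y = z\<close>, which is solvable because \<open>K\<^sup>T\<close> is injective.\<close>

lemma minimal_norm_preimage:
  assumes \<Sigma>: "pd_mat n \<Sigma>" and K: "K \<in> carrier_mat c n"
    and inj: "\<And>y. y \<in> carrier_vec c \<Longrightarrow> K\<^sup>T *\<^sub>v y = 0\<^sub>v n \<Longrightarrow> y = 0\<^sub>v c"
    and z: "z \<in> carrier_vec c"
  obtains \<xi> y where "\<xi> \<in> carrier_vec n" "y \<in> carrier_vec c" "K *\<^sub>v \<xi> = z"
    "\<xi> \<bullet> (minv \<Sigma> *\<^sub>v \<xi>) = y \<bullet> z" "(K\<^sup>T *\<^sub>v y) \<bullet> (\<Sigma> *\<^sub>v (K\<^sup>T *\<^sub>v y)) = y \<bullet> z"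
proof -
  have \<Sigma>c: "\<Sigma> \<in> carrier_mat n n" using \<Sigma> by (auto simp: pd_mat_def)
  note invS = pd_mat_minv[OF \<Sigma>]
  have KT: "K\<^sup>T \<in> carrier_mat n c" using K by simp
  define G where "G = K * (\<Sigma> * K\<^sup>T)"
  have G: "G \<in> carrier_mat c c" using K \<Sigma>c by (simp add: G_def)
  have Gy: "G *\<^sub>v y = K *\<^sub>v (\<Sigma> *\<^sub>v (K\<^sup>T *\<^sub>v y))" if y: "y \<in> carrier_vec c" for y
  proof -
    have "G *\<^sub>v y = K *\<^sub>v (\<Sigma> * K\<^sup>T *\<^sub>v y)"
      unfolding G_def by (rule assoc_mult_mat_vec) (use K KT \<Sigma>c y in auto)
    also have "\<Sigma> * K\<^sup>T *\<^sub>v y = \<Sigma> *\<^sub>v (K\<^sup>T *\<^sub>v y)" by (rule assoc_mult_mat_vec[OF \<Sigma>c KT y])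
    finally show ?thesis .
  qed
  have form: "(K\<^sup>T *\<^sub>v y) \<bullet> (\<Sigma> *\<^sub>v (K\<^sup>T *\<^sub>v y)) = y \<bullet> (G *\<^sub>v y)" if y: "y \<in> carrier_vec c" for y
    unfolding Gy[OF y]
    by (rule transpose_vec_mult_scalar[OF K _ y]) (use KT \<Sigma>c y in auto)
  have "y = 0\<^sub>v c" if y: "y \<in> carrier_vec c" and "G *\<^sub>v y = 0\<^sub>v c" for y
  proof (rule inj[OF y], rule ccontr)
    have KTy: "K\<^sup>T *\<^sub>v y \<in> carrier_vec n" using KT y by (rule mult_mat_vec_carrier)
    assume "K\<^sup>T *\<^sub>v y \<noteq> 0\<^sub>v n"
    then have "0 < (K\<^sup>T *\<^sub>v y) \<bullet> (\<Sigma> *\<^sub>v (K\<^sup>T *\<^sub>v y))" using \<Sigma> KTy unfolding pd_mat_def by blast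
    then show False using form[OF y] that by simp
  qed
  note invG = minv_inverse[OF G this]
  define y where "y = minv G *\<^sub>v z"
  define \<xi> where "\<xi> = \<Sigma> *\<^sub>v (K\<^sup>T *\<^sub>v y)"
  have y: "y \<in> carrier_vec c" using invG z by (simp add: y_def)
  have KTy: "K\<^sup>T *\<^sub>v y \<in> carrier_vec n" using KT y by (rule mult_mat_vec_carrier)
  have \<xi>: "\<xi> \<in> carrier_vec n" using \<Sigma>c KTy by (simp add: \<xi>_def)
  have Gyz: "G *\<^sub>v y = z" using assoc_mult_mat_vec[OF G invG(1) z] invG(2) z by (simp add: y_def)
  have "minv \<Sigma> *\<^sub>v \<xi> = K\<^sup>T *\<^sub>v y"
    using assoc_mult_mat_vec[OF invS(1) \<Sigma>c KTy] invS(3) KTy by (simp add: \<xi>_def)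
  then have "\<xi> \<bullet> (minv \<Sigma> *\<^sub>v \<xi>) = (K\<^sup>T *\<^sub>v y) \<bullet> \<xi>"
    using comm_scalar_prod[OF \<xi> KTy] by simp
  with form[OF y] Gyz Gy[OF y] y \<xi> show ?thesis by (intro that) (auto simp: \<xi>_def)
qed

text \<open>For \<open>M = \<lambda> I - Y\<close> the difference of the two sides is \<open>v \<bullet> Y \<Sigma> Y\<^sup>T v\<close>, since
  \<open>M \<Sigma> M\<^sup>T = \<lambda> (\<lambda> \<Sigma> - Y \<Sigma> - \<Sigma> Y\<^sup>T) + Y \<Sigma> Y\<^sup>T\<close>.\<close>

lemma Lyapunov_le_quadratic:
  assumes \<Sigma>: "pd_mat n \<Sigma>" and Y: "Y \<in> carrier_mat n n" and v: "v \<in> carrier_vec n"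
  shows "lam * (v \<bullet> ((lam \<cdot>\<^sub>m \<Sigma> - Y * \<Sigma> - \<Sigma> * Y\<^sup>T) *\<^sub>v v))
    \<le> ((lam \<cdot>\<^sub>m 1\<^sub>m n - Y)\<^sup>T *\<^sub>v v) \<bullet> (\<Sigma> *\<^sub>v ((lam \<cdot>\<^sub>m 1\<^sub>m n - Y)\<^sup>T *\<^sub>v v))"
proof -
  have S: "\<Sigma> \<in> carrier_mat n n" "\<Sigma>\<^sup>T = \<Sigma>" using \<Sigma> by (auto simp: pd_mat_def)
  have YT: "Y\<^sup>T \<in> carrier_mat n n" using Y by simp
  define r where "r = Y\<^sup>T *\<^sub>v v"
  have r: "r \<in> carrier_vec n" using YT v by (simp add: r_def)
  have Sv: "\<Sigma> *\<^sub>v v \<in> carrier_vec n" and Sr: "\<Sigma> *\<^sub>v r \<in> carrier_vec n" using S v r by auto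
  have lv: "(lam \<cdot>\<^sub>m X) *\<^sub>v v = lam \<cdot>\<^sub>v (X *\<^sub>v v)" if "X \<in> carrier_mat n n" for X
    using that v by (intro eq_vecI) auto
  have "(lam \<cdot>\<^sub>m \<Sigma> - Y * \<Sigma> - \<Sigma> * Y\<^sup>T) *\<^sub>v v = (lam \<cdot>\<^sub>m \<Sigma> - Y * \<Sigma>) *\<^sub>v v - (\<Sigma> * Y\<^sup>T) *\<^sub>v v"
    by (rule minus_mult_distrib_mat_vec) (use S Y YT v in \<open>auto intro!: minus_carrier_mat\<close>)
  also have "(lam \<cdot>\<^sub>m \<Sigma> - Y * \<Sigma>) *\<^sub>v v = (lam \<cdot>\<^sub>m \<Sigma>) *\<^sub>v v - (Y * \<Sigma>) *\<^sub>v v"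
    by (rule minus_mult_distrib_mat_vec) (use S Y v in auto)
  also have "(Y * \<Sigma>) *\<^sub>v v = Y *\<^sub>v (\<Sigma> *\<^sub>v v)" by (rule assoc_mult_mat_vec[OF Y S(1) v])
  also have "(\<Sigma> * Y\<^sup>T) *\<^sub>v v = \<Sigma> *\<^sub>v r" unfolding r_def by (rule assoc_mult_mat_vec[OF S(1) YT v])
  also have "(lam \<cdot>\<^sub>m \<Sigma>) *\<^sub>v v = lam \<cdot>\<^sub>v (\<Sigma> *\<^sub>v v)" by (rule lv[OF S(1)])
  finally have "v \<bullet> ((lam \<cdot>\<^sub>m \<Sigma> - Y * \<Sigma> - \<Sigma> * Y\<^sup>T) *\<^sub>v v)
      = lam * (v \<bullet> (\<Sigma> *\<^sub>v v)) - v \<bullet> (Y *\<^sub>v (\<Sigma> *\<^sub>v v)) - v \<bullet> (\<Sigma> *\<^sub>v r)"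
    using v Sv Sr Y by (simp add: scalar_prod_minus_distrib[of _ n])
  also have "v \<bullet> (Y *\<^sub>v (\<Sigma> *\<^sub>v v)) = r \<bullet> (\<Sigma> *\<^sub>v v)"
    unfolding r_def by (rule transpose_vec_mult_scalar[OF Y Sv v, symmetric])
  also have "r \<bullet> (\<Sigma> *\<^sub>v v) = v \<bullet> (\<Sigma> *\<^sub>v r)" by (rule scalar_prod_symmetric_mat[OF S r v])
  finally have lhs: "v \<bullet> ((lam \<cdot>\<^sub>m \<Sigma> - Y * \<Sigma> - \<Sigma> * Y\<^sup>T) *\<^sub>v v)
      = lam * (v \<bullet> (\<Sigma> *\<^sub>v v)) - 2 * (v \<bullet> (\<Sigma> *\<^sub>v r))" by simp
  have "(lam \<cdot>\<^sub>m 1\<^sub>m n - Y)\<^sup>T *\<^sub>v v = lam \<cdot>\<^sub>v v + (-1) \<cdot>\<^sub>v r"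
  proof -
    have "(lam \<cdot>\<^sub>m 1\<^sub>m n - Y)\<^sup>T = lam \<cdot>\<^sub>m 1\<^sub>m n - Y\<^sup>T" using Y by (intro eq_matI) auto
    then have "(lam \<cdot>\<^sub>m 1\<^sub>m n - Y)\<^sup>T *\<^sub>v v = (lam \<cdot>\<^sub>m 1\<^sub>m n) *\<^sub>v v - r"
      using minus_mult_distrib_mat_vec[of "lam \<cdot>\<^sub>m 1\<^sub>m n" n n "Y\<^sup>T" v] YT v by (simp add: r_def)
    also have "(lam \<cdot>\<^sub>m 1\<^sub>m n) *\<^sub>v v = lam \<cdot>\<^sub>v v" using lv[of "1\<^sub>m n"] v by simp
    finally show ?thesis using v r by (auto intro!: eq_vecI)
  qed
  then have "((lam \<cdot>\<^sub>m 1\<^sub>m n - Y)\<^sup>T *\<^sub>v v) \<bullet> (\<Sigma> *\<^sub>v ((lam \<cdot>\<^sub>m 1\<^sub>m n - Y)\<^sup>T *\<^sub>v v))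
      = (lam \<cdot>\<^sub>v v) \<bullet> (\<Sigma> *\<^sub>v (lam \<cdot>\<^sub>v v)) - 2 * ((lam \<cdot>\<^sub>v v) \<bullet> (\<Sigma> *\<^sub>v r)) + r \<bullet> (\<Sigma> *\<^sub>v r)"
    using quadratic_form_add_smult[OF S _ r, of "lam \<cdot>\<^sub>v v" "-1"] v by simp
  also have "\<dots> = lam * (lam * (v \<bullet> (\<Sigma> *\<^sub>v v)) - 2 * (v \<bullet> (\<Sigma> *\<^sub>v r))) + r \<bullet> (\<Sigma> *\<^sub>v r)"
    using v Sv Sr r by (simp add: mult_mat_vec[OF S(1) v] algebra_simps)
  finally show ?thesis
    using lhs pd_mat_imp_psd_mat[OF \<Sigma>] r by (simp add: psd_mat_def)
qed

text \<open>Evaluate the block matrix at \<open>(- \<lambda> y, w, \<xi>)\<close>. With \<open>q\<close> the common value in the last two assumptions,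
  the Lyapunov term is at most \<open>\<lambda> q\<close>, the cross terms give \<open>- 2 \<lambda> q\<close> and the last block
  \<open>(\<lambda> - \<beta>) q\<close>; all multiples of \<open>\<lambda> q\<close> cancel and \<open>\<beta> (w \<bullet> \<Sigma>\<^sup>-\<^sup>1 w - q) \<ge> 0\<close> remains.\<close>

lemma LMI_imp_norm_le:
  assumes \<Sigma>: "pd_mat n \<Sigma>" and Y: "Y \<in> carrier_mat n n" and E: "E \<in> carrier_mat c n"
    and B: "B \<in> carrier_mat c n" and C: "C \<in> carrier_mat c n"
    and lam: "0 < lam" and beta: "0 < \<beta>"
    and LMI: "psd_mat (c + n + n) (block33
        (E * (lam \<cdot>\<^sub>m \<Sigma> - Y * \<Sigma> - \<Sigma> * Y\<^sup>T) * E\<^sup>T) B C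
        B\<^sup>T (\<beta> \<cdot>\<^sub>m minv \<Sigma>) (0\<^sub>m n n) C\<^sup>T (0\<^sub>m n n) ((lam - \<beta>) \<cdot>\<^sub>m minv \<Sigma>))"
    and w: "w \<in> carrier_vec n" and \<xi>: "\<xi> \<in> carrier_vec n" and y: "y \<in> carrier_vec c"
    and q1: "\<xi> \<bullet> (minv \<Sigma> *\<^sub>v \<xi>) = y \<bullet> (B *\<^sub>v w + C *\<^sub>v \<xi>)"
    and q2: "((E * (lam \<cdot>\<^sub>m 1\<^sub>m n - Y))\<^sup>T *\<^sub>v y) \<bullet> (\<Sigma> *\<^sub>v ((E * (lam \<cdot>\<^sub>m 1\<^sub>m n - Y))\<^sup>T *\<^sub>v y))
        = y \<bullet> (B *\<^sub>v w + C *\<^sub>v \<xi>)"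
  shows "\<xi> \<bullet> (minv \<Sigma> *\<^sub>v \<xi>) \<le> w \<bullet> (minv \<Sigma> *\<^sub>v w)"
proof -
  let ?S = "lam \<cdot>\<^sub>m \<Sigma> - Y * \<Sigma> - \<Sigma> * Y\<^sup>T"
  have \<Sigma>c: "\<Sigma> \<in> carrier_mat n n" using \<Sigma> by (auto simp: pd_mat_def)
  have I: "minv \<Sigma> \<in> carrier_mat n n" by (rule pd_mat_minv(1)[OF \<Sigma>])
  have S: "?S \<in> carrier_mat n n" using \<Sigma>c Y by (auto intro!: minus_carrier_mat)
  have M: "lam \<cdot>\<^sub>m 1\<^sub>m n - Y \<in> carrier_mat n n" using Y by (auto intro!: minus_carrier_mat)
  have PT: "E\<^sup>T \<in> carrier_mat n c" using E by simp
  define v where "v = E\<^sup>T *\<^sub>v y"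
  have v: "v \<in> carrier_vec n" unfolding v_def by (rule mult_mat_vec_carrier[OF PT y])
  define q where "q = y \<bullet> (B *\<^sub>v w + C *\<^sub>v \<xi>)"
  have MT: "(E * (lam \<cdot>\<^sub>m 1\<^sub>m n - Y))\<^sup>T *\<^sub>v y = (lam \<cdot>\<^sub>m 1\<^sub>m n - Y)\<^sup>T *\<^sub>v v"
    unfolding v_def transpose_mult[OF E M]
    by (rule assoc_mult_mat_vec) (use M PT y in auto)
  have le: "lam * (v \<bullet> (?S *\<^sub>v v)) \<le> q"
    using Lyapunov_le_quadratic[OF \<Sigma> Y v, of lam] q2 unfolding MT by (simp add: q_def)
  have A: "E * ?S * E\<^sup>T \<in> carrier_mat c c" using E S PT by auto
  have Ay: "y' \<bullet> (E * ?S * E\<^sup>T *\<^sub>v y') = (E\<^sup>T *\<^sub>v y') \<bullet> (?S *\<^sub>v (E\<^sup>T *\<^sub>v y'))"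
    if y': "y' \<in> carrier_vec c" for y'
  proof -
    have v': "E\<^sup>T *\<^sub>v y' \<in> carrier_vec n" by (rule mult_mat_vec_carrier[OF PT y'])
    have "E * ?S * E\<^sup>T *\<^sub>v y' = E * ?S *\<^sub>v (E\<^sup>T *\<^sub>v y')"
      by (rule assoc_mult_mat_vec[OF mult_carrier_mat[OF E S] PT y'])
    also have "\<dots> = E *\<^sub>v (?S *\<^sub>v (E\<^sup>T *\<^sub>v y'))" by (rule assoc_mult_mat_vec[OF E S v'])
    finally show ?thesis
      using transpose_vec_mult_scalar[OF E mult_mat_vec_carrier[OF S v'] y'] by simp
  qed
  let ?y = "(- lam) \<cdot>\<^sub>v y"
  have y': "?y \<in> carrier_vec c" using y by simp
  have "E\<^sup>T *\<^sub>v ?y = (- lam) \<cdot>\<^sub>v v" unfolding v_def by (rule mult_mat_vec[OF PT y])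
  then have quad: "?y \<bullet> (E * ?S * E\<^sup>T *\<^sub>v ?y) = lam\<^sup>2 * (v \<bullet> (?S *\<^sub>v v))"
    unfolding Ay[OF y'] using v S mult_mat_vec_carrier[OF S v]
    by (simp only: mult_mat_vec[OF S v]) (simp add: power2_eq_square)
  have smult: "p \<bullet> (k \<cdot>\<^sub>m minv \<Sigma> *\<^sub>v p) = k * (p \<bullet> (minv \<Sigma> *\<^sub>v p))" if p: "p \<in> carrier_vec n" for p k
  proof -
    have "k \<cdot>\<^sub>m minv \<Sigma> *\<^sub>v p = k \<cdot>\<^sub>v (minv \<Sigma> *\<^sub>v p)" using I p by (intro eq_vecI) auto
    then show ?thesis using I p by simp
  qed
  have Bw: "B *\<^sub>v w \<in> carrier_vec c" and C\<xi>: "C *\<^sub>v \<xi> \<in> carrier_vec c" using B C w \<xi> by auto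
  have "0 \<le> ?y \<bullet> (E * ?S * E\<^sup>T *\<^sub>v ?y) + 2 * (?y \<bullet> (B *\<^sub>v w)) + 2 * (?y \<bullet> (C *\<^sub>v \<xi>))
      + w \<bullet> (\<beta> \<cdot>\<^sub>m minv \<Sigma> *\<^sub>v w) + \<xi> \<bullet> ((lam - \<beta>) \<cdot>\<^sub>m minv \<Sigma> *\<^sub>v \<xi>)"
    by (rule block33_form[OF LMI A B C _ _ y' w \<xi>]) (use I in auto)
  also have "\<dots> = lam\<^sup>2 * (v \<bullet> (?S *\<^sub>v v)) - 2 * lam * q + \<beta> * (w \<bullet> (minv \<Sigma> *\<^sub>v w)) + (lam - \<beta>) * q"
    using q1 unfolding quad smult[OF w] smult[OF \<xi>]
    using y Bw C\<xi> by (simp add: q_def scalar_prod_add_distrib[of _ c] algebra_simps)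
  also have "\<dots> \<le> lam * q - 2 * lam * q + \<beta> * (w \<bullet> (minv \<Sigma> *\<^sub>v w)) + (lam - \<beta>) * q"
    using mult_left_mono[OF le, of lam] lam by (simp add: power2_eq_square mult.assoc)
  also have "\<dots> = \<beta> * (w \<bullet> (minv \<Sigma> *\<^sub>v w) - q)" by (simp add: algebra_simps)
  finally show ?thesis using beta q1 by (simp add: q_def zero_le_mult_iff)
qed

text \<open>A zero diagonal block of a positive semidefinite matrix annihilates its row and column.\<close>

lemma LMI_imp_zero:
  assumes A: "A \<in> carrier_mat c c" and B: "B \<in> carrier_mat c n" and C: "C \<in> carrier_mat c m"
    and F: "F \<in> carrier_mat m m"
    and LMI: "psd_mat (c + n + m) (block33 A B C B\<^sup>T (0\<^sub>m n n) (0\<^sub>m n m) C\<^sup>T (0\<^sub>m m n) F)"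
    and w: "w \<in> carrier_vec n"
  shows "B *\<^sub>v w = 0\<^sub>v c"
proof -
  define y where "y = B *\<^sub>v w"
  define a where "a = y \<bullet> (A *\<^sub>v y)"
  define b where "b = y \<bullet> y"
  have y: "y \<in> carrier_vec c" using B w by (simp add: y_def)
  have form: "0 \<le> s\<^sup>2 * a + 2 * s * b" for s
  proof -
    have sy: "s \<cdot>\<^sub>v y \<in> carrier_vec c" using y by simp
    have "0 \<le> (s \<cdot>\<^sub>v y) \<bullet> (A *\<^sub>v (s \<cdot>\<^sub>v y)) + 2 * ((s \<cdot>\<^sub>v y) \<bullet> (B *\<^sub>v w)) + 2 * ((s \<cdot>\<^sub>v y) \<bullet> (C *\<^sub>v 0\<^sub>v m))
        + w \<bullet> (0\<^sub>m n n *\<^sub>v w) + 0\<^sub>v m \<bullet> (F *\<^sub>v 0\<^sub>v m)"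
      by (rule block33_form[OF LMI A B C _ F sy w]) auto
    moreover have "C *\<^sub>v 0\<^sub>v m = 0\<^sub>v c" "0\<^sub>m n n *\<^sub>v w = 0\<^sub>v n"
      using C w by (auto intro!: eq_vecI simp: scalar_prod_def)
    ultimately show ?thesis
      using y w F A by (simp add: y_def[symmetric] a_def b_def mult_mat_vec[OF A y] power2_eq_square mult.assoc)
  qed
  have "b = 0"
  proof (rule ccontr)
    assume "b \<noteq> 0"
    then have b: "b > 0" using scalar_prod_self_nonneg[of y] by (simp add: b_def)
    show False
    proof (cases "a > 0")
      case True
      have "(- b / a)\<^sup>2 * a + 2 * (- b / a) * b = - (b\<^sup>2 / a)"
        using True by (simp add: field_simps power2_eq_square)
      then have "b\<^sup>2 / a \<le> 0" using form[of "- b / a"] by linarith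
      moreover have "b\<^sup>2 / a > 0" using True b by simp
      ultimately show False by simp
    next
      case False
      then show False using form[of "-1"] b by simp
    qed
  qed
  then show ?thesis using scalar_prod_self_eq_0[OF y] by (simp add: y_def b_def)
qed

text \<open>The second equation is the surrogate state response: \<open>\<Pi> M \<xi>\<close> replaces \<open>\<Pi> (x - v\<^sub>0)\<close> both as the
  input of \<open>H\<close> and, through \<open>Q\<^sup>\<xi> = Q\<^sup>v M\<close>, in the control law.\<close>

lemma surrogate_response:
  assumes S: "valid_system S" and SM: "surrogate_matrices S Bt Lt Ht"
    and Qw: "Qw \<in> carrier_mat (Nu S) (Nx S)" and Q\<xi>: "Q\<xi> \<in> sparse_gain S (Cset S)" and Y: "Y \<in> Ysub S"
    and lam: "lam \<noteq> 0"
    and ubar: "ubar \<in> carrier_vec (Nu S)" and vbar: "vbar \<in> carrier_vec (Nx S)"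
    and x: "x \<in> carrier_vec (Nx S)" and w: "w \<in> carrier_vec (Nx S)" and \<xi>: "\<xi> \<in> carrier_vec (Nx S)"
    and eq: "projC S *\<^sub>v x = projC S *\<^sub>v (vbar + (lam \<cdot>\<^sub>m 1\<^sub>m (Nx S) - Y) *\<^sub>v \<xi>)"
  shows "Q\<xi> * minv (lam \<cdot>\<^sub>m 1\<^sub>m (Nx S) - Y) *\<^sub>v (x - vbar) = Q\<xi> *\<^sub>v \<xi>" (is ?gain)
    and "Bt *\<^sub>v (ubar + Qw *\<^sub>v w + Q\<xi> *\<^sub>v \<xi>) + Lt *\<^sub>v w + Ht *\<^sub>v (projC S *\<^sub>v x)
      = Bt *\<^sub>v ubar + Ht *\<^sub>v (projC S *\<^sub>v vbar) + (Bt * Qw + Lt) *\<^sub>v w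
        + (Bt * Q\<xi> + Ht * (projC S * (lam \<cdot>\<^sub>m 1\<^sub>m (Nx S) - Y))) *\<^sub>v \<xi>" (is ?response)
proof -
  define M where "M = lam \<cdot>\<^sub>m 1\<^sub>m (Nx S) - Y"
  note inv = resolvent_inverse[OF Y lam, folded M_def]
  have K: "Q\<xi> * minv M \<in> sparse_gain S (Cset S)"
    unfolding M_def by (rule sparse_gain_resolvent[OF S Q\<xi> Y lam])
  have B: "Bt \<in> carrier_mat (Nx S) (Nu S)" and L: "Lt \<in> carrier_mat (Nx S) (Nx S)"
    and H: "Ht \<in> carrier_mat (Nx S) (NxC S)" using SM by (auto simp: surrogate_matrices_def)
  have Qc: "Q\<xi> \<in> carrier_mat (Nu S) (Nx S)" using Q\<xi> by (simp add: sparse_gain_def)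
  note Pc = projC_carrier[of S]
  have M\<xi>: "M *\<^sub>v \<xi> \<in> carrier_vec (Nx S)" using inv(1) \<xi> by simp
  have eq: "projC S *\<^sub>v x = projC S *\<^sub>v vbar + projC S *\<^sub>v (M *\<^sub>v \<xi>)"
    using eq mult_add_distrib_mat_vec[OF Pc vbar M\<xi>] by (simp add: M_def)
  have "projC S *\<^sub>v (x - vbar) = projC S *\<^sub>v x - projC S *\<^sub>v vbar"
    by (rule mult_minus_distrib_mat_vec[OF Pc x vbar])
  also have "\<dots> = projC S *\<^sub>v (M *\<^sub>v \<xi>)" unfolding eq using Pc by (intro eq_vecI) auto
  finally have "Q\<xi> * minv M *\<^sub>v (x - vbar) = Q\<xi> * minv M *\<^sub>v (M *\<^sub>v \<xi>)"
    by (intro sparse_gain_projC_cong[OF S K _ M\<xi>]) (use x vbar in auto)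
  also have "\<dots> = Q\<xi> *\<^sub>v (minv M *\<^sub>v (M *\<^sub>v \<xi>))" by (rule assoc_mult_mat_vec[OF Qc inv(2) M\<xi>])
  also have "minv M *\<^sub>v (M *\<^sub>v \<xi>) = \<xi>" using assoc_mult_mat_vec[OF inv(2,1) \<xi>] inv(4) \<xi> by simp
  finally show ?gain by (simp add: M_def)
  have Qwv: "Qw *\<^sub>v w \<in> carrier_vec (Nu S)" and Q\<xi>v: "Q\<xi> *\<^sub>v \<xi> \<in> carrier_vec (Nu S)"
    using Qw Qc w \<xi> by auto
  have "Bt *\<^sub>v (ubar + Qw *\<^sub>v w + Q\<xi> *\<^sub>v \<xi>) = Bt *\<^sub>v ubar + Bt *\<^sub>v (Qw *\<^sub>v w) + Bt *\<^sub>v (Q\<xi> *\<^sub>v \<xi>)"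
    by (rule mult_mat_vec_add3[OF B ubar Qwv Q\<xi>v])
  moreover have "Ht *\<^sub>v (projC S *\<^sub>v x) = Ht *\<^sub>v (projC S *\<^sub>v vbar) + Ht *\<^sub>v (projC S *\<^sub>v (M *\<^sub>v \<xi>))"
    unfolding eq by (rule mult_add_distrib_mat_vec[OF H]) (use Pc vbar M\<xi> in \<open>auto intro: mult_mat_vec_carrier\<close>)
  moreover have "(Bt * Qw + Lt) *\<^sub>v w = Bt *\<^sub>v (Qw *\<^sub>v w) + Lt *\<^sub>v w"
    using add_mult_distrib_mat_vec[of "Bt * Qw" "Nx S" "Nx S" Lt w] B Qw L w
    by (simp add: assoc_mult_mat_vec[OF B Qw w])
  moreover have "(Bt * Q\<xi> + Ht * (projC S * M)) *\<^sub>v \<xi> = Bt *\<^sub>v (Q\<xi> *\<^sub>v \<xi>) + Ht *\<^sub>v (projC S *\<^sub>v (M *\<^sub>v \<xi>))"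
  proof -
    have PM: "projC S * M \<in> carrier_mat (NxC S) (Nx S)" using Pc inv(1) by auto
    have "(Bt * Q\<xi> + Ht * (projC S * M)) *\<^sub>v \<xi> = Bt * Q\<xi> *\<^sub>v \<xi> + Ht * (projC S * M) *\<^sub>v \<xi>"
      by (rule add_mult_distrib_mat_vec) (use B Qc H PM \<xi> in auto)
    then show ?thesis
      using assoc_mult_mat_vec[OF B Qc \<xi>] assoc_mult_mat_vec[OF H PM \<xi>] assoc_mult_mat_vec[OF Pc inv(1) \<xi>]
      by simp
  qed
  ultimately show ?response
    unfolding M_def[symmetric] using B L H by (intro eq_vecI) auto
qed

section \<open>Feasibility of the affine policy\<close>

theorem mainTheorem2:
  fixes P :: "'o dproblem"
    and \<Sigma> Qw Q\<xi> Y Pw P\<xi> Bt Lt Ht :: "real mat"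
    and ubar vbar xbar :: "real vec"
    and lam \<beta> :: real
  assumes "valid_problem P"
    and "surrogate_matrices P Bt Lt Ht"
    and "pd_mat (Nx P) \<Sigma>"
    and "noise_support P = {z \<in> carrier_vec (Nx P). z \<bullet> (minv \<Sigma> *\<^sub>v z) \<le> 1}"
    and "Qw \<in> QN P" and "Q\<xi> \<in> QC P" and "Y \<in> Ysub P"
    and "ubar \<in> carrier_vec (Nu P)"
    and "Pw \<in> carrier_mat (Nx P) (Nx P)" and "P\<xi> \<in> carrier_mat (Nx P) (Nx P)"
    and "vbar \<in> carrier_vec (Nx P)" and "xbar \<in> carrier_vec (Nx P)"
    and "0 \<le> lam" and "0 \<le> \<beta>" and "max 1 \<beta> \<le> lam"
    and "xbar = Bt *\<^sub>v ubar + Ht *\<^sub>v (projC P *\<^sub>v vbar)"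
    and "Pw = Bt * Qw + Lt"
    and "P\<xi> = Bt * Q\<xi> + Ht * (projC P * (lam \<cdot>\<^sub>m 1\<^sub>m (Nx P) - Y))"
    and "\<forall>i<ncon P.
           eucl_norm (mat_sqrt \<Sigma> *\<^sub>v ((Fx P * Pw + Fu P * Qw + Fw P)\<^sup>T *\<^sub>v unit_vec (ncon P) i))
           + eucl_norm (mat_sqrt \<Sigma> *\<^sub>v ((Fx P * P\<xi> + Fu P * Q\<xi>)\<^sup>T *\<^sub>v unit_vec (ncon P) i))
           \<le> unit_vec (ncon P) i \<bullet> (gbound P - Fx P *\<^sub>v xbar - Fu P *\<^sub>v ubar)"
    and "projC P *\<^sub>v (xbar - vbar) = 0\<^sub>v (NxC P)"
    and "psd_mat (NxC P + Nx P + Nx P)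
           (block33
              (projC P * (lam \<cdot>\<^sub>m \<Sigma> - Y * \<Sigma> - \<Sigma> * Y\<^sup>T) * (projC P)\<^sup>T) (projC P * Pw) (projC P * P\<xi>)
              (Pw\<^sup>T * (projC P)\<^sup>T) (\<beta> \<cdot>\<^sub>m minv \<Sigma>) (0\<^sub>m (Nx P) (Nx P))
              (P\<xi>\<^sup>T * (projC P)\<^sup>T) (0\<^sub>m (Nx P) (Nx P)) ((lam - \<beta>) \<cdot>\<^sub>m minv \<Sigma>))"
  shows "\<exists>\<phi>.
           (\<forall>w\<in>carrier_vec (Nx P). \<forall>x\<in>carrier_vec (Nx P).
              \<phi> w (projC P *\<^sub>v x) =
                ubar + Qw *\<^sub>v w + (Q\<xi> * minv (lam \<cdot>\<^sub>m 1\<^sub>m (Nx P) - Y)) *\<^sub>v (x - vbar))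
           \<and> feasible_D P \<phi>"
proof -
  note ubar = assms(8) and vbar = assms(11) and xbar = assms(12) and Pw = assms(9) and P\<xi> = assms(10)
    and xbar_eq = assms(16) and Pw_eq = assms(17) and P\<xi>_eq = assms(18)
    and norm_bound = assms(19) and nominal_consistent = assms(20) and LMI = assms(21)
  have S: "valid_system P" and F: "Fx P \<in> carrier_mat (ncon P) (Nx P)" "Fu P \<in> carrier_mat (ncon P) (Nu P)"
    "Fw P \<in> carrier_mat (ncon P) (Nx P)" and g: "gbound P \<in> carrier_vec (ncon P)"
    using assms(1) by (auto simp: valid_problem_def)
  note SM = assms(2) and \<Sigma> = assms(3) and Y = assms(7)
  have lam: "0 < lam" "lam \<noteq> 0" using assms(15) by auto
  have Qw: "Qw \<in> sparse_gain P (Nset P)" using assms(5) QN_subset_sparse_gain by blast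
  have Q\<xi>: "Q\<xi> \<in> sparse_gain P (Cset P)" using assms(6) QC_subset_sparse_gain by blast
  define M where "M = lam \<cdot>\<^sub>m 1\<^sub>m (Nx P) - Y"
  define K where "K = Q\<xi> * minv M"
  define C where "C = projC P"
  have C: "C \<in> carrier_mat (NxC P) (Nx P)" unfolding C_def by (rule projC_carrier)
  have CT: "C\<^sup>T \<in> carrier_mat (Nx P) (NxC P)" using C by simp
  have Yc: "Y \<in> carrier_mat (Nx P) (Nx P)" using Y by (simp add: Ysub_def)
  have \<Sigma>c: "\<Sigma> \<in> carrier_mat (Nx P) (Nx P)" using \<Sigma> by (simp add: pd_mat_def)
  note invM = resolvent_inverse[OF Y lam(2), folded M_def]
  have K: "K \<in> sparse_gain P (Cset P)"
    unfolding K_def M_def by (rule sparse_gain_resolvent[OF S Q\<xi> Y lam(2)])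
  have Kc: "K \<in> carrier_mat (Nu P) (Nx P)" and Qwc: "Qw \<in> carrier_mat (Nu P) (Nx P)"
    and Q\<xi>c: "Q\<xi> \<in> carrier_mat (Nu P) (Nx P)"
    using K Qw Q\<xi> by (auto simp: sparse_gain_def)

  \<comment> \<open>The nominal offset of the feedback is moved into the constant, leaving feedback that is linear in the data.\<close>
  define c where "c = ubar - K *\<^sub>v vbar"
  define \<phi> where "\<phi> = (\<lambda>w y. c + Qw *\<^sub>v w + K *\<^sub>v (C\<^sup>T *\<^sub>v y))"
  have c: "c \<in> carrier_vec (Nu P)" using ubar Kc vbar by (simp add: c_def)
  have \<phi>: "\<phi> \<in> policies P" unfolding \<phi>_def C_def by (rule affine_policy[OF S c Qw K])
  have \<phi>_eq: "\<phi> w (C *\<^sub>v x) = c + Qw *\<^sub>v w + K *\<^sub>v x" if x: "x \<in> carrier_vec (Nx P)" for w x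
  proof -
    have Cx: "C *\<^sub>v x \<in> carrier_vec (NxC P)" by (rule mult_mat_vec_carrier[OF C x])
    have "K *\<^sub>v (C\<^sup>T *\<^sub>v (C *\<^sub>v x)) = K *\<^sub>v x"
      using projC_transpose_right_inverse[OF S, of "C *\<^sub>v x"] Cx x
      by (intro sparse_gain_projC_cong[OF S K mult_mat_vec_carrier[OF CT Cx] x]) (simp add: C_def)
    then show ?thesis by (simp add: \<phi>_def)
  qed
  have gain_form: "c + Qw *\<^sub>v w + K *\<^sub>v x = ubar + Qw *\<^sub>v w + K *\<^sub>v (x - vbar)"
    if x: "x \<in> carrier_vec (Nx P)" for w x
    unfolding c_def mult_minus_distrib_mat_vec[OF Kc x vbar] using ubar Qwc Kc by (intro eq_vecI) auto

  have loop_iff: "closed_loop P \<phi> w x u \<longleftrightarrow>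
      x \<in> carrier_vec (Nx P) \<and> dynamics P x (c + Qw *\<^sub>v w + K *\<^sub>v x) w \<and> u = c + Qw *\<^sub>v w + K *\<^sub>v x"
    if w: "w \<in> carrier_vec (Nx P)" for w x u
  proof -
    have "c + Qw *\<^sub>v w + K *\<^sub>v x \<in> carrier_vec (Nu P)" if "x \<in> carrier_vec (Nx P)"
      using c Qwc Kc w that by simp
    then show ?thesis using \<phi>_eq[of x w] by (auto simp: closed_loop_def C_def)
  qed

  have feasible: "(\<exists>!(x, u). closed_loop P \<phi> w x u) \<and>
      (\<forall>x u. closed_loop P \<phi> w x u \<longrightarrow> constraints P x u w)"
    if "w \<in> noise_support P" for w
  proof -
    have w: "w \<in> carrier_vec (Nx P)" and wW: "w \<bullet> (minv \<Sigma> *\<^sub>v w) \<le> 1"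
      using that assms(4) by auto
    have cw: "c + Qw *\<^sub>v w \<in> carrier_vec (Nu P)" using c Qwc w by simp
    from closed_loop_equation[OF S SM K cw w] obtain x where x: "x \<in> carrier_vec (Nx P)" "dynamics P x (c + Qw *\<^sub>v w + K *\<^sub>v x) w"
      and x_unique: "\<And>x'. x' \<in> carrier_vec (Nx P) \<Longrightarrow> dynamics P x' (c + Qw *\<^sub>v w + K *\<^sub>v x') w \<Longrightarrow> x' = x"
      by blast
    define u where "u = c + Qw *\<^sub>v w + K *\<^sub>v x"
    have u: "u \<in> carrier_vec (Nu P)" using cw Kc x by (simp add: u_def)
    have loop: "closed_loop P \<phi> w x' u' \<longleftrightarrow> x' = x \<and> u' = u" for x' u'
      unfolding loop_iff[OF w] u_def using x x_unique by metis

    have response: "ubar + Qw *\<^sub>v w + K *\<^sub>v (x' - vbar) = ubar + Qw *\<^sub>v w + Q\<xi> *\<^sub>v \<xi>"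
      "dynamics P x' (c + Qw *\<^sub>v w + K *\<^sub>v x') w \<longleftrightarrow> x' = xbar + Pw *\<^sub>v w + P\<xi> *\<^sub>v \<xi>"
      if \<xi>: "\<xi> \<in> carrier_vec (Nx P)" and x': "x' \<in> carrier_vec (Nx P)"
        and eq: "C *\<^sub>v x' = C *\<^sub>v (vbar + M *\<^sub>v \<xi>)" for \<xi> x'
    proof -
      note r = surrogate_response[OF S SM Qwc Q\<xi> Y lam(2) ubar vbar x' w \<xi> eq[unfolded C_def M_def],
        folded M_def, folded K_def, folded P\<xi>_eq[folded M_def] Pw_eq xbar_eq]
      show u': "ubar + Qw *\<^sub>v w + K *\<^sub>v (x' - vbar) = ubar + Qw *\<^sub>v w + Q\<xi> *\<^sub>v \<xi>" by (simp add: r(1))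
      have "ubar + Qw *\<^sub>v w + Q\<xi> *\<^sub>v \<xi> \<in> carrier_vec (Nu P)" using ubar Qwc Q\<xi>c w \<xi> by simp
      then show "dynamics P x' (c + Qw *\<^sub>v w + K *\<^sub>v x') w \<longleftrightarrow> x' = xbar + Pw *\<^sub>v w + P\<xi> *\<^sub>v \<xi>"
        unfolding gain_form[OF x'] u' using dynamics_iff_matrices[OF S SM x' _ w] r(2) by simp
    qed

    define E1 where "E1 = C * Pw"
    define E2 where "E2 = C * P\<xi>"
    have E: "E1 \<in> carrier_mat (NxC P) (Nx P)" "E2 \<in> carrier_mat (NxC P) (Nx P)"
      using C Pw P\<xi> by (auto simp: E1_def E2_def)
    have LMI': "psd_mat (NxC P + Nx P + Nx P) (block33
        (C * (lam \<cdot>\<^sub>m \<Sigma> - Y * \<Sigma> - \<Sigma> * Y\<^sup>T) * C\<^sup>T) E1 E2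
        E1\<^sup>T (\<beta> \<cdot>\<^sub>m minv \<Sigma>) (0\<^sub>m (Nx P) (Nx P)) E2\<^sup>T (0\<^sub>m (Nx P) (Nx P)) ((lam - \<beta>) \<cdot>\<^sub>m minv \<Sigma>))"
      using LMI transpose_mult[OF C Pw] transpose_mult[OF C P\<xi>] by (simp add: E1_def E2_def C_def)
    have I: "minv \<Sigma> \<in> carrier_mat (Nx P) (Nx P)" by (rule pd_mat_minv(1)[OF \<Sigma>])
    have xv: "C *\<^sub>v (xbar + Pw *\<^sub>v w + P\<xi> *\<^sub>v \<xi>) = C *\<^sub>v vbar + (E1 *\<^sub>v w + E2 *\<^sub>v \<xi>)"
      if \<xi>: "\<xi> \<in> carrier_vec (Nx P)" for \<xi>
    proof -
      have Pv: "Pw *\<^sub>v w \<in> carrier_vec (Nx P)" "P\<xi> *\<^sub>v \<xi> \<in> carrier_vec (Nx P)" using Pw P\<xi> w \<xi> by auto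
      have "C *\<^sub>v xbar - C *\<^sub>v vbar = 0\<^sub>v (NxC P)"
        using nominal_consistent mult_minus_distrib_mat_vec[OF C xbar vbar] by (simp add: C_def)
      then have "(C *\<^sub>v xbar - C *\<^sub>v vbar) $ i = 0" if "i < NxC P" for i using that by simp
      then have "C *\<^sub>v xbar = C *\<^sub>v vbar" using C by (intro eq_vecI) auto
      moreover have "C *\<^sub>v (xbar + Pw *\<^sub>v w + P\<xi> *\<^sub>v \<xi>) = C *\<^sub>v xbar + C *\<^sub>v (Pw *\<^sub>v w) + C *\<^sub>v (P\<xi> *\<^sub>v \<xi>)"
        by (rule mult_mat_vec_add3[OF C xbar Pv])
      ultimately show ?thesis
        using assoc_mult_mat_vec[OF C Pw w] assoc_mult_mat_vec[OF C P\<xi> \<xi>] C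
        assoc_add_vec[OF mult_mat_vec_carrier[OF C vbar] mult_mat_vec_carrier[OF C Pv(1)]
            mult_mat_vec_carrier[OF C Pv(2)]]
        by (simp add: E1_def E2_def)
    qed

    obtain \<xi> where \<xi>: "\<xi> \<in> carrier_vec (Nx P)" "\<xi> \<bullet> (minv \<Sigma> *\<^sub>v \<xi>) \<le> 1"
      "x = xbar + Pw *\<^sub>v w + P\<xi> *\<^sub>v \<xi>" "C *\<^sub>v x = C *\<^sub>v (vbar + M *\<^sub>v \<xi>)"
    proof (cases "\<beta> = 0")
      case True
      \<comment> \<open>The trajectory generated by \<open>\<xi> = 0\<close> satisfies the closed loop equations, so it is \<open>x\<close>.\<close>
      have "0 \<cdot>\<^sub>m minv \<Sigma> = 0\<^sub>m (Nx P) (Nx P)" using I by (intro eq_matI) auto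
      then have LMI0: "psd_mat (NxC P + Nx P + Nx P) (block33
          (C * (lam \<cdot>\<^sub>m \<Sigma> - Y * \<Sigma> - \<Sigma> * Y\<^sup>T) * C\<^sup>T) E1 E2
          E1\<^sup>T (0\<^sub>m (Nx P) (Nx P)) (0\<^sub>m (Nx P) (Nx P)) E2\<^sup>T (0\<^sub>m (Nx P) (Nx P)) (lam \<cdot>\<^sub>m minv \<Sigma>))"
        using LMI' True by simp
      have "lam \<cdot>\<^sub>m \<Sigma> - Y * \<Sigma> - \<Sigma> * Y\<^sup>T \<in> carrier_mat (Nx P) (Nx P)"
        using \<Sigma>c Yc by (auto intro!: minus_carrier_mat)
      then have "C * (lam \<cdot>\<^sub>m \<Sigma> - Y * \<Sigma> - \<Sigma> * Y\<^sup>T) * C\<^sup>T \<in> carrier_mat (NxC P) (NxC P)"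
        by (intro mult_carrier_mat[OF mult_carrier_mat[OF C] CT])
      then have "E1 *\<^sub>v w = 0\<^sub>v (NxC P)"
        by (rule LMI_imp_zero[OF _ E _ LMI0 w]) (use I in simp)
      moreover have "E2 *\<^sub>v 0\<^sub>v (Nx P) = 0\<^sub>v (NxC P)" "M *\<^sub>v 0\<^sub>v (Nx P) = 0\<^sub>v (Nx P)"
        using E invM(1) by (auto intro!: eq_vecI simp: scalar_prod_def)
      ultimately have eq: "C *\<^sub>v (xbar + Pw *\<^sub>v w + P\<xi> *\<^sub>v 0\<^sub>v (Nx P)) = C *\<^sub>v (vbar + M *\<^sub>v 0\<^sub>v (Nx P))"
        using xv[of "0\<^sub>v (Nx P)"] C vbar by simp
      have x': "xbar + Pw *\<^sub>v w + P\<xi> *\<^sub>v 0\<^sub>v (Nx P) \<in> carrier_vec (Nx P)" using xbar Pw P\<xi> w by simp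
      have "xbar + Pw *\<^sub>v w + P\<xi> *\<^sub>v 0\<^sub>v (Nx P) = x"
        by (rule x_unique[OF x']) (simp add: response(2)[OF _ x' eq])
      then show ?thesis using eq I by (intro that[of "0\<^sub>v (Nx P)"]) auto
    next
      case False
      then have beta: "0 < \<beta>" using assms(14) by simp
      have CM: "C * M \<in> carrier_mat (NxC P) (Nx P)" using C invM(1) by simp
      note inj = projC_mult_transpose_injective[OF S invM(1-3), folded C_def]
      have z: "C *\<^sub>v (x - vbar) \<in> carrier_vec (NxC P)"
        by (rule mult_mat_vec_carrier[OF C]) (use x vbar in simp)
      obtain \<xi> y where \<xi>: "\<xi> \<in> carrier_vec (Nx P)" and y: "y \<in> carrier_vec (NxC P)"
        and rep: "C * M *\<^sub>v \<xi> = C *\<^sub>v (x - vbar)" "\<xi> \<bullet> (minv \<Sigma> *\<^sub>v \<xi>) = y \<bullet> (C *\<^sub>v (x - vbar))"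
          "((C * M)\<^sup>T *\<^sub>v y) \<bullet> (\<Sigma> *\<^sub>v ((C * M)\<^sup>T *\<^sub>v y)) = y \<bullet> (C *\<^sub>v (x - vbar))"
        using minimal_norm_preimage[OF \<Sigma> CM inj z] by metis
      have M\<xi>: "M *\<^sub>v \<xi> \<in> carrier_vec (Nx P)" using invM(1) \<xi> by simp
      have "C *\<^sub>v (vbar + M *\<^sub>v \<xi>) = C *\<^sub>v vbar + C *\<^sub>v (x - vbar)"
        using mult_add_distrib_mat_vec[OF C vbar M\<xi>] assoc_mult_mat_vec[OF C invM(1) \<xi>] rep(1) by simp
      also have "\<dots> = C *\<^sub>v x"
        unfolding mult_minus_distrib_mat_vec[OF C x(1) vbar] using C by (intro eq_vecI) auto
      finally have eq: "C *\<^sub>v x = C *\<^sub>v (vbar + M *\<^sub>v \<xi>)" ..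
      have x\<xi>: "x = xbar + Pw *\<^sub>v w + P\<xi> *\<^sub>v \<xi>" using response(2)[OF \<xi> x(1) eq] x(2) by simp
      have "C *\<^sub>v (x - vbar) = C *\<^sub>v x - C *\<^sub>v vbar" by (rule mult_minus_distrib_mat_vec[OF C x(1) vbar])
      also have "\<dots> = E1 *\<^sub>v w + E2 *\<^sub>v \<xi>"
        unfolding x\<xi> xv[OF \<xi>] using C E by (intro eq_vecI) auto
      finally have zeta: "C *\<^sub>v (x - vbar) = E1 *\<^sub>v w + E2 *\<^sub>v \<xi>" .
      have "\<xi> \<bullet> (minv \<Sigma> *\<^sub>v \<xi>) \<le> w \<bullet> (minv \<Sigma> *\<^sub>v w)"
        by (rule LMI_imp_norm_le[OF \<Sigma> Yc C E lam(1) beta LMI' w \<xi> y])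
          (use rep zeta in \<open>simp_all add: M_def\<close>)
      then have "\<xi> \<bullet> (minv \<Sigma> *\<^sub>v \<xi>) \<le> 1" using wW by simp
      then show ?thesis using \<xi> x\<xi> eq by (intro that)
    qed
    have u_eq: "u = ubar + Qw *\<^sub>v w + Q\<xi> *\<^sub>v \<xi>"
      unfolding u_def gain_form[OF x(1)] by (rule response(1)[OF \<xi>(1) x(1) \<xi>(4)])

    define K1 where "K1 = Fx P * Pw + Fu P * Qw + Fw P"
    define K2 where "K2 = Fx P * P\<xi> + Fu P * Q\<xi>"
    have Kx: "K1 \<in> carrier_mat (ncon P) (Nx P)" "K2 \<in> carrier_mat (ncon P) (Nx P)"
      using F Pw P\<xi> Qwc Q\<xi>c by (auto simp: K1_def K2_def)
    have K1w: "K1 *\<^sub>v w = Fx P *\<^sub>v (Pw *\<^sub>v w) + Fu P *\<^sub>v (Qw *\<^sub>v w) + Fw P *\<^sub>v w"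
      unfolding K1_def using F Pw Qwc w
      by (simp add: add_mult_distrib_mat_vec[of _ "ncon P" "Nx P"] assoc_mult_mat_vec[OF F(1) Pw w]
          assoc_mult_mat_vec[OF F(2) Qwc w])
    have K2\<xi>: "K2 *\<^sub>v \<xi> = Fx P *\<^sub>v (P\<xi> *\<^sub>v \<xi>) + Fu P *\<^sub>v (Q\<xi> *\<^sub>v \<xi>)"
      unfolding K2_def using F P\<xi> Q\<xi>c \<xi>(1)
      by (simp add: add_mult_distrib_mat_vec[of _ "ncon P" "Nx P"] assoc_mult_mat_vec[OF F(1) P\<xi> \<xi>(1)]
          assoc_mult_mat_vec[OF F(2) Q\<xi>c \<xi>(1)])
    have Fxx: "Fx P *\<^sub>v x = Fx P *\<^sub>v xbar + Fx P *\<^sub>v (Pw *\<^sub>v w) + Fx P *\<^sub>v (P\<xi> *\<^sub>v \<xi>)"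
      unfolding \<xi>(3) by (rule mult_mat_vec_add3[OF F(1) xbar]) (use Pw P\<xi> w \<xi>(1) in auto)
    have Fuu: "Fu P *\<^sub>v u = Fu P *\<^sub>v ubar + Fu P *\<^sub>v (Qw *\<^sub>v w) + Fu P *\<^sub>v (Q\<xi> *\<^sub>v \<xi>)"
      unfolding u_eq by (rule mult_mat_vec_add3[OF F(2) ubar]) (use Qwc Q\<xi>c w \<xi>(1) in auto)
    have "constraints P x u w"
      unfolding constraints_def less_eq_vec_def
    proof (intro conjI allI impI)
      fix i assume "i < dim_vec (gbound P)"
      then have i: "i < ncon P" using g by simp
      let ?e = "unit_vec (ncon P) i :: real vec"
      have "eucl_norm (mat_sqrt \<Sigma> *\<^sub>v (K1\<^sup>T *\<^sub>v ?e)) + eucl_norm (mat_sqrt \<Sigma> *\<^sub>v (K2\<^sup>T *\<^sub>v ?e))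
          \<le> ?e \<bullet> (gbound P - Fx P *\<^sub>v xbar - Fu P *\<^sub>v ubar)"
        using norm_bound i unfolding K1_def K2_def by blast
      also have "\<dots> = gbound P $ i - (Fx P *\<^sub>v xbar) $ i - (Fu P *\<^sub>v ubar) $ i"
      proof -
        have "gbound P - Fx P *\<^sub>v xbar - Fu P *\<^sub>v ubar \<in> carrier_vec (ncon P)"
          using g F xbar ubar by (auto intro!: minus_carrier_vec mult_mat_vec_carrier)
        then show ?thesis using i F by simp
      qed
      finally have "(K1 *\<^sub>v w) $ i + (K2 *\<^sub>v \<xi>) $ i \<le> gbound P $ i - (Fx P *\<^sub>v xbar) $ i - (Fu P *\<^sub>v ubar) $ i"
        using ellipsoid_row_bound[OF \<Sigma> Kx(1) i w wW] ellipsoid_row_bound[OF \<Sigma> Kx(2) i \<xi>(1,2)]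
        by linarith
      then show "(Fx P *\<^sub>v x + Fu P *\<^sub>v u + Fw P *\<^sub>v w) $ i \<le> gbound P $ i"
        unfolding Fxx Fuu K1w K2\<xi> using i F by simp
    qed (use F g in simp)
    then show ?thesis using loop by auto
  qed
  have form: "\<phi> w (projC P *\<^sub>v x) = ubar + Qw *\<^sub>v w + (Q\<xi> * minv (lam \<cdot>\<^sub>m 1\<^sub>m (Nx P) - Y)) *\<^sub>v (x - vbar)"
    if "x \<in> carrier_vec (Nx P)" for w x
    using \<phi>_eq[OF that] gain_form[OF that] by (simp add: C_def K_def M_def)
  have "feasible_D P \<phi>"
    unfolding feasible_D_def by (rule conjI[OF \<phi>], rule ballI, rule feasible)
  with form show ?thesis by (intro exI[of _ \<phi>] conjI ballI)
qed

end
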